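(* Problem (SDIPTC$_\infty$) can be solved by Algorithm A (both described in the context) in $O(n)$ time.
   Context: Let $T=(V,E)$ be a tree rooted at $s$ with node set $V=\{s,v_1,\dots,v_n\}$ and edge set $E=\{e_1,\dots,e_n\}$, and let $Y=\{t_1,\dots,t_r\}$ be its set of leaf nodes. Each edge $e$ has an original weight $w(e)$, an upper bound $u(e)$ and a unit modification cost $c(e)$, with $u(e)\ge w(e)\ge 0$ and $c(e)>0$. For $t_k\in Y$, $P_k$ is the path from $s$ to $t_k$. For $e\in E$, $L(e)=\{t_k\in Y: e\in P_k\}$. For an edge weight vector $x$, put $x(P_k)=\sum_{e\in P_k}x(e)$ and $x(T)=\sum_{t_k\in Y}x(P_k)$ (the sum of root-leaf distances). $H(a,b)=0$ if $a=b$ and $H(a,b)=1$ if $a\ne b$. Given values $K$ and $N$, problem (SDIPTC$_\infty$) is: maximize $\tilde w(T)$ over $\tilde w$ subject to $\max_{e\in E}c(e)(\tilde w(e)-w(e))\le K$, $\sum_{e\in E}H(\tilde w(e),w(e))\le N$, and $w(e)\le\tilde w(e)\le u(e)$ for all $e\in E$. Algorithm A (input $T,n,w,u,c,K,N$; output $\tilde w$ and $\tilde w(T)$): 1. Compute $\bar w(e):=w(e)+\min\{K/c(e),\,u(e)-w(e)\}$ for all $e\in E$, and $\bar w(T)$. 2. For each $e\in E$ determine $L(e)$ and calculate $\bar S(e):=|L(e)|(\bar w(e)-w(e))$. 3. Using a linear-time selection algorithm, find the $N$-th largest element $\bar S^N$ of $\{\bar S(e): e\in E\}$, and put $\bar E_N:=\{e\in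 E:\bar S(e)\ge\bar S^N\}$. 4. Put $\tilde w(e):=\bar w(e)$ for $e\in\bar E_N$ and $\tilde w(e):=w(e)$ otherwise, and compute $\tilde w(T):=\sum_{t_k\in Y}\tilde w(P_k)$. 5. Return $[\tilde w,\tilde w(T)]$.
   Formalization: K ≥ 0 is assumed; in Step 3, if ties make the set {S̄(e) ≥ S̄^N} exceed N edges, only enough tied edges are taken to get N (N > n is read as n, N = 0 selects none); Step 2 computes only |L(e)|, not the sets L(e). *)

theory Defs
  imports Complex_Main "HOL-Library.Landau_Symbols" "HOL-Library.Monad_Syntax" "HOL-Library.Multiset"
begin

section \<open>Trees rooted at node 0\<close>

text \<open>
  A graph with \<open>n\<close> edges has the nodes \<open>0, ..., n\<close> and the edges \<open>1, ..., n\<close>; \<open>ends e\<close> lists the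
  two end points of edge \<open>e\<close> in an arbitrary order (edges are undirected). Node \<open>0\<close> is the root.
  The constant \<open>tree\<close> of the AFP entry on graph theory only forbids directed cycles and therefore
  does not describe undirected trees.
\<close>

type_synonym graph = "nat \<Rightarrow> nat \<times> nat"

definition nodes :: "nat \<Rightarrow> nat set" where
  "nodes n = {0..n}"

definition edges :: "nat \<Rightarrow> nat set" where
  "edges n = {1..n}"

definition joins :: "graph \<Rightarrow> nat \<Rightarrow> nat \<Rightarrow> nat \<Rightarrow> bool" where
  "joins ends e a b \<longleftrightarrow> ends e = (a, b) \<or> ends e = (b, a)"

text \<open>A walk is the list of its steps, each consisting of an edge and the node reached by it.\<close>

fun walk :: "nat \<Rightarrow> graph \<Rightarrow> nat \<Rightarrow> (nat \<times> nat) list \<Rightarrow> nat \<Rightarrow> bool" where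
  "walk n ends a [] b \<longleftrightarrow> a = b"
| "walk n ends a ((e, v) # p) b \<longleftrightarrow> e \<in> edges n \<and> joins ends e a v \<and> walk n ends v p b"

definition path :: "nat \<Rightarrow> graph \<Rightarrow> nat \<Rightarrow> (nat \<times> nat) list \<Rightarrow> nat \<Rightarrow> bool" where
  "path n ends a p b \<longleftrightarrow> walk n ends a p b \<and> distinct (a # map snd p)"

text \<open>Loops and pairs of parallel edges count as cycles.\<close>

definition cycle :: "nat \<Rightarrow> graph \<Rightarrow> nat \<Rightarrow> (nat \<times> nat) list \<Rightarrow> bool" where
  "cycle n ends a p \<longleftrightarrow>
     p \<noteq> [] \<and> walk n ends a p a \<and> distinct (map fst p) \<and> distinct (map snd p)"

definition is_tree :: "nat \<Rightarrow> graph \<Rightarrow> bool" where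
  "is_tree n ends \<longleftrightarrow>
     (\<forall>e\<in>edges n. fst (ends e) \<in> nodes n \<and> snd (ends e) \<in> nodes n) \<and>
     (\<forall>a\<in>nodes n. \<forall>b\<in>nodes n. \<exists>p. walk n ends a p b) \<and>
     \<not> (\<exists>a\<in>nodes n. \<exists>p. cycle n ends a p)"

definition incident :: "nat \<Rightarrow> graph \<Rightarrow> nat \<Rightarrow> nat set" where
  "incident n ends v = {e \<in> edges n. v = fst (ends e) \<or> v = snd (ends e)}"

definition leaves :: "nat \<Rightarrow> graph \<Rightarrow> nat set" where
  "leaves n ends = {v \<in> nodes n. v \<noteq> 0 \<and> card (incident n ends v) = 1}"

definition root_path :: "nat \<Rightarrow> graph \<Rightarrow> nat \<Rightarrow> nat set" where
  "root_path n ends t = fst ` set (THE p. path n ends 0 p t)"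

definition leaves_below :: "nat \<Rightarrow> graph \<Rightarrow> nat \<Rightarrow> nat set" where
  "leaves_below n ends e = {t \<in> leaves n ends. e \<in> root_path n ends t}"

definition path_weight :: "nat \<Rightarrow> graph \<Rightarrow> (nat \<Rightarrow> real) \<Rightarrow> nat \<Rightarrow> real" where
  "path_weight n ends x t = (\<Sum>e\<in>root_path n ends t. x e)"

definition tree_weight :: "nat \<Rightarrow> graph \<Rightarrow> (nat \<Rightarrow> real) \<Rightarrow> real" where
  "tree_weight n ends x = (\<Sum>t\<in>leaves n ends. path_weight n ends x t)"


section \<open>The problem\<close>

record sdiptc =
  size_of :: nat
  ends_of :: graph
  weight :: "nat \<Rightarrow> real"
  upper :: "nat \<Rightarrow> real"
  unit_cost :: "nat \<Rightarrow> real"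
  cost_bound :: real
  count_bound :: nat

definition edges_of :: "sdiptc \<Rightarrow> nat set" where
  "edges_of I = edges (size_of I)"

definition valid_instance :: "sdiptc \<Rightarrow> bool" where
  "valid_instance I \<longleftrightarrow>
     size_of I \<ge> 1 \<and> is_tree (size_of I) (ends_of I) \<and>
     (\<forall>e\<in>edges_of I. 0 \<le> weight I e \<and> weight I e \<le> upper I e \<and> 0 < unit_cost I e) \<and>
     0 \<le> cost_bound I"

definition total_distance :: "sdiptc \<Rightarrow> (nat \<Rightarrow> real) \<Rightarrow> real" where
  "total_distance I x = tree_weight (size_of I) (ends_of I) x"

definition hamming :: "real \<Rightarrow> real \<Rightarrow> nat" where
  "hamming a b = (if a = b then 0 else 1)"

definition feasible :: "sdiptc \<Rightarrow> (nat \<Rightarrow> real) \<Rightarrow> bool" where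
  "feasible I x \<longleftrightarrow>
     (MAX e\<in>edges_of I. unit_cost I e * (x e - weight I e)) \<le> cost_bound I \<and>
     (\<Sum>e\<in>edges_of I. hamming (x e) (weight I e)) \<le> count_bound I \<and>
     (\<forall>e\<in>edges_of I. weight I e \<le> x e \<and> x e \<le> upper I e)"

definition optimal :: "sdiptc \<Rightarrow> (nat \<Rightarrow> real) \<Rightarrow> bool" where
  "optimal I x \<longleftrightarrow> feasible I x \<and> (\<forall>y. feasible I y \<longrightarrow> total_distance I y \<le> total_distance I x)"


section \<open>The vector produced by Algorithm A, as a mathematical object\<close>

definition max_weight :: "sdiptc \<Rightarrow> nat \<Rightarrow> real" where
  "max_weight I e = weight I e + min (cost_bound I / unit_cost I e) (upper I e - weight I e)"

definition gain :: "sdiptc \<Rightarrow> nat \<Rightarrow> real" where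
  "gain I e = real (card (leaves_below (size_of I) (ends_of I) e)) * (max_weight I e - weight I e)"

text \<open>
  The \<open>N\<close>-th largest gain, counting equal gains with multiplicity. A value of \<open>N\<close> larger than the
  number of edges is replaced by that number; \<open>N = 0\<close> yields the maximum, above which there is
  no edge.
\<close>

definition threshold :: "sdiptc \<Rightarrow> real" where
  "threshold I =
     rev (sort (map (gain I) [1..<Suc (size_of I)])) ! (min (count_bound I) (size_of I) - 1)"

text \<open>
  If several edges share the threshold value, the set of all edges with gain at least the threshold
  may have more than \<open>N\<close> elements, and changing all of them would be infeasible. Then only as many
  of the tied edges are taken (an arbitrary choice of them) as are needed to get \<open>N\<close> edges. If that
  set has exactly \<open>N\<close> elements, it is the only set satisfying this predicate.
\<close>

definition selected :: "sdiptc \<Rightarrow> nat set \<Rightarrow> bool" where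
  "selected I F \<longleftrightarrow>
     {e \<in> edges_of I. gain I e > threshold I} \<subseteq> F \<and>
     F \<subseteq> {e \<in> edges_of I. gain I e \<ge> threshold I} \<and>
     card F = min (count_bound I) (size_of I)"

definition output_of_A :: "sdiptc \<Rightarrow> (nat \<Rightarrow> real) \<Rightarrow> bool" where
  "output_of_A I x \<longleftrightarrow>
     (\<exists>F. selected I F \<and>
       (\<forall>e\<in>edges_of I. x e = (if e \<in> F then max_weight I e else weight I e)))"


section \<open>Running times\<close>

text \<open>
  A timed computation is a result together with the number of elementary steps spent on it.
  \<open>step v\<close> charges one unit for evaluating an expression \<open>v\<close> consisting of a fixed number of
  arithmetic operations and comparisons on numbers, reads and writes of single array cells, and
  constructions and inspections of list cells and tuples (the unit-cost real RAM). Everything else,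
  i.e. every loop, is written as a recursive function charging for each iteration. Arrays are
  functions on indices, with \<open>fun_upd\<close> as writing; they are only used single-threadedly, so that
  every write can be done in place. \<open>ret\<close> and the conditionals are free because each recursive
  function charges at least one unit per call.
\<close>

type_synonym 'a timed = "'a \<times> nat"

definition ret :: "'a \<Rightarrow> 'a timed" where
  "ret v = (v, 0)"

definition step :: "'a \<Rightarrow> 'a timed" where
  "step v = (v, 1)"

definition bind_timed :: "'a timed \<Rightarrow> ('a \<Rightarrow> 'b timed) \<Rightarrow> 'b timed" where
  "bind_timed m f = (let r = f (fst m) in (fst r, snd m + snd r))"

adhoc_overloading Monad_Syntax.bind \<rightleftharpoons> bind_timed

lemma bind_timed_cong [fundef_cong]:
  "m = m' \<Longrightarrow> (\<And>v. v = fst m' \<Longrightarrow> f v = f' v) \<Longrightarrow> bind_timed m f = bind_timed m' f'"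
  by (simp add: bind_timed_def)

text \<open>Allocating and initialising an array with the index range \<open>0, ..., n\<close>.\<close>

definition new_array :: "nat \<Rightarrow> 'a \<Rightarrow> (nat \<Rightarrow> 'a) timed" where
  "new_array n v = ((\<lambda>_. v), Suc n)"


section \<open>Linear-time selection (median of medians of groups of five)\<close>

fun length_t :: "'a list \<Rightarrow> nat timed" where
  "length_t [] = step 0"
| "length_t (x # xs) = do { k \<leftarrow> length_t xs; step (Suc k) }"

fun nth_t :: "real list \<Rightarrow> nat \<Rightarrow> real timed" where
  "nth_t [] k = step 0"
| "nth_t (x # xs) 0 = step x"
| "nth_t (x # xs) (Suc k) = do { v \<leftarrow> nth_t xs k; step v }"

fun rev_t :: "'a list \<Rightarrow> 'a list \<Rightarrow> 'a list timed" where
  "rev_t [] ys = step ys"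
| "rev_t (x # xs) ys = do { zs \<leftarrow> step (x # ys); rev_t xs zs }"

fun insert_t :: "real \<Rightarrow> real list \<Rightarrow> real list timed" where
  "insert_t x [] = step [x]"
| "insert_t x (y # ys) =
     (if y \<le> x then step (x # y # ys) else do { zs \<leftarrow> insert_t x ys; step (y # zs) })"

text \<open>Descending insertion sort; it is only applied to lists of bounded length.\<close>

fun sort_t :: "real list \<Rightarrow> real list timed" where
  "sort_t [] = step []"
| "sort_t (x # xs) = do { ys \<leftarrow> sort_t xs; zs \<leftarrow> insert_t x ys; step zs }"

fun medians_t :: "real list \<Rightarrow> real list timed" where
  "medians_t (a # b # c # d # e # xs) =
     do { ys \<leftarrow> sort_t [a, b, c, d, e]; m \<leftarrow> nth_t ys 2; ms \<leftarrow> medians_t xs; step (m # ms) }"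
| "medians_t xs = step []"

fun split_t :: "real \<Rightarrow> real list \<Rightarrow> (real list \<times> real list \<times> real list) timed" where
  "split_t p [] = step ([], [], [])"
| "split_t p (x # xs) =
     do { (gs, es, ls) \<leftarrow> split_t p xs;
          step (if x > p then (x # gs, es, ls)
                else if x = p then (gs, x # es, ls) else (gs, es, x # ls)) }"

text \<open>\<open>select_t k xs\<close> is the element at position \<open>k\<close>, counted from \<open>0\<close>, of \<open>xs\<close> in descending order.\<close>

function (domintros) select_t :: "nat \<Rightarrow> real list \<Rightarrow> real timed" where
  "select_t k xs =
     do { n \<leftarrow> length_t xs;
          if n < 100 then do { ys \<leftarrow> sort_t xs; nth_t ys k }
          else do {
            ms \<leftarrow> medians_t xs;
            q \<leftarrow> length_t ms;
            p \<leftarrow> select_t (q div 2) ms;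
            (gs, es, ls) \<leftarrow> split_t p xs;
            a \<leftarrow> length_t gs;
            b \<leftarrow> length_t es;
            if k < a then select_t k gs
            else if k < a + b then step p
            else select_t (k - (a + b)) ls } }"
  by pat_completeness auto

lemma fst_simps [simp]:
  "fst (bind_timed m f) = fst (f (fst m))" "fst (step v) = v" "fst (ret v) = v"
  by (simp_all add: bind_timed_def step_def ret_def Let_def)

lemma fst_length_t [simp]: "fst (length_t xs) = length xs"
  by (induction xs) auto

lemma fst_nth_t: "k < length xs \<Longrightarrow> fst (nth_t xs k) = xs ! k"
  by (induction xs k rule: nth_t.induct) auto

lemma mset_insert_t: "mset (fst (insert_t x ys)) = add_mset x (mset ys)"
  by (induction ys) auto

lemma mset_sort_t: "mset (fst (sort_t xs)) = mset xs"
  by (induction xs) (auto simp: mset_insert_t)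

lemma length_sort_t: "length (fst (sort_t xs)) = length xs"
  using mset_sort_t mset_eq_length by blast

lemma set_sort_t: "set (fst (sort_t xs)) = set xs"
  using mset_sort_t mset_eq_setD by blast

lemma nth_sort_t: "k < length xs \<Longrightarrow> fst (nth_t (fst (sort_t xs)) k) \<in> set xs"
  by (metis fst_nth_t length_sort_t nth_mem set_sort_t)

lemma set_medians_t: "set (fst (medians_t xs)) \<subseteq> set xs"
proof (induction xs rule: medians_t.induct)
  case (1 a b c d e xs)
  have "fst (nth_t (fst (sort_t [a, b, c, d, e])) 2) \<in> set [a, b, c, d, e]"
    by (rule nth_sort_t) simp
  with 1 show ?case by (auto simp del: sort_t.simps)
qed auto

lemma length_medians_t: "length (fst (medians_t xs)) = length xs div 5"
  by (induction xs rule: medians_t.induct) auto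

lemma fst_split_t: "fst (split_t p xs) =
    (filter (\<lambda>x. x > p) xs, filter (\<lambda>x. x = p) xs, filter (\<lambda>x. x < p) xs)"
  by (induction xs) (auto split: prod.splits)

lemma length_filter_split:
  "length (filter (\<lambda>x. x > p) xs) + length (filter (\<lambda>x. x = p) xs)
     + length (filter (\<lambda>x. x < p) xs) = length xs" for p :: real
  by (induction xs) auto

lemma select_t_in_set:
  assumes "select_t_dom (k, xs)" "k < length xs"
  shows "fst (select_t k xs) \<in> set xs"
  using assms
proof (induction k xs rule: select_t.pinduct)
  case (1 k xs)
  define p where "p = fst (select_t (length (fst (medians_t xs)) div 2) (fst (medians_t xs)))"
  show ?case
  proof (cases "length xs < 100")
    case True
    then show ?thesis
      using 1 by (simp add: select_t.psimps nth_sort_t)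
  next
    case False
    have p: "p \<in> set xs"
      using 1(2)[OF refl _ refl refl] False set_medians_t[of xs]
      by (auto simp: p_def length_medians_t)
    note split = fst_split_t[of p xs]
    let ?gs = "filter (\<lambda>x. x > p) xs" and ?es = "filter (\<lambda>x. x = p) xs"
      and ?ls = "filter (\<lambda>x. x < p) xs"
    have gs: "fst (select_t k ?gs) \<in> set ?gs" if "k < length ?gs"
      using 1(3)[of "length xs" "fst (medians_t xs)" "length (fst (medians_t xs))" p
          "(?gs, ?es, ?ls)" ?gs "(?es, ?ls)" ?es ?ls "length ?gs" "length ?es"]
        False that split by (simp add: p_def)
    have ls: "fst (select_t (k - (length ?gs + length ?es)) ?ls) \<in> set ?ls"
      if "\<not> k < length ?gs" "\<not> k < length ?gs + length ?es"
      using 1(4)[of "length xs" "fst (medians_t xs)" "length (fst (medians_t xs))" p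
          "(?gs, ?es, ?ls)" ?gs "(?es, ?ls)" ?es ?ls "length ?gs" "length ?es"]
        False that split length_filter_split[of p xs] "1.prems" by (simp add: p_def)
    have "fst (select_t k xs) = (if k < length ?gs then fst (select_t k ?gs)
       else if k < length ?gs + length ?es then p
       else fst (select_t (k - (length ?gs + length ?es)) ?ls))"
      using False split by (simp add: select_t.psimps[OF 1(1)] p_def)
    then show ?thesis
      using gs ls p by auto
  qed
qed

termination
proof (relation "measure (length \<circ> snd)", goal_cases)
  case 1
  show ?case by simp
next
  case (2 k xs n ms q)
  then show ?case by (simp add: length_medians_t)
next
  case (3 k xs n ms q p)
  then have "p \<in> set xs"
    using select_t_in_set[of "q div 2" ms] set_medians_t[of xs] by (auto simp: length_medians_t)
  with 3 show ?case by (auto simp: fst_split_t intro!: length_filter_less)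
next
  case (4 k xs n ms q p)
  then have "p \<in> set xs"
    using select_t_in_set[of "q div 2" ms] set_medians_t[of xs] by (auto simp: length_medians_t)
  with 4 show ?case by (auto simp: fst_split_t intro!: length_filter_less)
qed


section \<open>Algorithm A as a program\<close>

text \<open>Incidence lists of all nodes.\<close>

fun incidence_t :: "graph \<Rightarrow> nat \<Rightarrow> (nat \<Rightarrow> nat list) \<Rightarrow> (nat \<Rightarrow> nat list) timed" where
  "incidence_t ends 0 inc = step inc"
| "incidence_t ends (Suc e) inc =
     do { (a, b) \<leftarrow> step (ends (Suc e));
          inc1 \<leftarrow> step (inc(a := Suc e # inc a));
          inc2 \<leftarrow> step (inc1(b := Suc e # inc1 b));
          incidence_t ends e inc2 }"

definition opposite :: "graph \<Rightarrow> nat \<Rightarrow> nat \<Rightarrow> nat" where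
  "opposite ends e v = (if fst (ends e) = v then snd (ends e) else fst (ends e))"

text \<open>
  The tree is traversed from the root. A triple \<open>(v, e, x)\<close> says that the edge \<open>e\<close> leads from the
  node \<open>v\<close> to its child \<open>x\<close>. \<open>push_t\<close> puts the edges from \<open>x\<close> to its children on the stack, \<open>e\<close> being
  the edge to the parent of \<open>x\<close>; the root is treated with the non-existent edge \<open>0\<close>. \<open>traverse_t\<close>
  handles one edge per iteration and collects the triples, those met last coming first.
\<close>

type_synonym arc = "nat \<times> nat \<times> nat"

fun push_t :: "graph \<Rightarrow> nat \<Rightarrow> nat \<Rightarrow> nat list \<Rightarrow> arc list \<Rightarrow> arc list timed" where
  "push_t ends e x [] st = step st"
| "push_t ends e x (f # fs) st =
     do { st' \<leftarrow> step (if f = e then st else (x, f, opposite ends f x) # st);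
          push_t ends e x fs st' }"

fun traverse_t :: "graph \<Rightarrow> (nat \<Rightarrow> nat list) \<Rightarrow> nat \<Rightarrow> arc list \<Rightarrow> arc list \<Rightarrow> arc list timed" where
  "traverse_t ends inc 0 st acc = step acc"
| "traverse_t ends inc (Suc k) [] acc = step acc"
| "traverse_t ends inc (Suc k) ((v, e, x) # st) acc =
     do { acc' \<leftarrow> step ((v, e, x) # acc);
          st' \<leftarrow> push_t ends e x (inc x) st;
          traverse_t ends inc k st' acc' }"

definition is_leaf :: "(nat \<Rightarrow> nat list) \<Rightarrow> nat \<Rightarrow> bool" where
  "is_leaf inc x = (case inc x of [_] \<Rightarrow> True | _ \<Rightarrow> False)"

text \<open>
  Given the arcs bottom-up, compute for each edge the number of leaves below it; \<open>cnt\<close> collects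
  the numbers of leaves below the nodes.
\<close>

fun leaf_counts_t ::
  "(nat \<Rightarrow> nat list) \<Rightarrow> arc list \<Rightarrow> (nat \<Rightarrow> nat) \<Rightarrow> (nat \<Rightarrow> nat) \<Rightarrow> (nat \<Rightarrow> nat) timed" where
  "leaf_counts_t inc [] cnt L = step L"
| "leaf_counts_t inc ((v, e, x) # as) cnt L =
     do { k \<leftarrow> step (if is_leaf inc x then 1 else cnt x);
          cnt' \<leftarrow> step (cnt(v := cnt v + k));
          L' \<leftarrow> step (L(e := k));
          leaf_counts_t inc as cnt' L' }"

text \<open>
  Given the arcs top-down, compute the distances \<open>d\<close> from the root with respect to \<open>x\<close>, and add up
  those of the leaves.
\<close>

fun distances_t ::
  "(nat \<Rightarrow> nat list) \<Rightarrow> (nat \<Rightarrow> real) \<Rightarrow> arc list \<Rightarrow> (nat \<Rightarrow> real) \<Rightarrow> real \<Rightarrow> real timed" where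
  "distances_t inc x [] d r = step r"
| "distances_t inc x ((v, e, y) # as) d r =
     do { d' \<leftarrow> step (d(y := d v + x e));
          r' \<leftarrow> step (if is_leaf inc y then r + d' y else r);
          distances_t inc x as d' r' }"

definition tree_weight_t ::
  "nat \<Rightarrow> (nat \<Rightarrow> nat list) \<Rightarrow> arc list \<Rightarrow> (nat \<Rightarrow> real) \<Rightarrow> real timed" where
  "tree_weight_t n inc as x = do { d \<leftarrow> new_array n 0; distances_t inc x as d 0 }"

fun max_weights_t :: "sdiptc \<Rightarrow> nat \<Rightarrow> (nat \<Rightarrow> real) \<Rightarrow> (nat \<Rightarrow> real) timed" where
  "max_weights_t I 0 wb = step wb"
| "max_weights_t I (Suc e) wb =
     do { wb' \<leftarrow> step (wb(Suc e := weight I (Suc e)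
            + min (cost_bound I / unit_cost I (Suc e)) (upper I (Suc e) - weight I (Suc e))));
          max_weights_t I e wb' }"

fun gains_t ::
  "sdiptc \<Rightarrow> (nat \<Rightarrow> nat) \<Rightarrow> (nat \<Rightarrow> real) \<Rightarrow> nat \<Rightarrow> (nat \<Rightarrow> real) \<Rightarrow> (nat \<Rightarrow> real) timed" where
  "gains_t I L wb 0 S = step S"
| "gains_t I L wb (Suc e) S =
     do { S' \<leftarrow> step (S(Suc e := real (L (Suc e)) * (wb (Suc e) - weight I (Suc e))));
          gains_t I L wb e S' }"

fun to_list_t :: "(nat \<Rightarrow> real) \<Rightarrow> nat \<Rightarrow> real list \<Rightarrow> real list timed" where
  "to_list_t S 0 xs = step xs"
| "to_list_t S (Suc e) xs = do { xs' \<leftarrow> step (S (Suc e) # xs); to_list_t S e xs' }"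

fun count_above_t :: "(nat \<Rightarrow> real) \<Rightarrow> real \<Rightarrow> nat \<Rightarrow> nat timed" where
  "count_above_t S t 0 = step 0"
| "count_above_t S t (Suc e) =
     do { k \<leftarrow> count_above_t S t e; step (if S (Suc e) > t then Suc k else k) }"

text \<open>\<open>r\<close> is the number of edges with gain equal to the threshold \<open>t\<close> that may still be taken.\<close>

fun assign_t :: "sdiptc \<Rightarrow> (nat \<Rightarrow> real) \<Rightarrow> (nat \<Rightarrow> real) \<Rightarrow> real \<Rightarrow> nat \<Rightarrow> nat \<Rightarrow>
    (nat \<Rightarrow> real) \<Rightarrow> (nat \<Rightarrow> real) timed" where
  "assign_t I wb S t r 0 x = step x"
| "assign_t I wb S t r (Suc e) x =
     do { take_it \<leftarrow> step (S (Suc e) > t \<or> (S (Suc e) = t \<and> r > 0));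
          r' \<leftarrow> step (if S (Suc e) = t then r - 1 else r);
          x' \<leftarrow> step (x(Suc e := (if take_it then wb (Suc e) else weight I (Suc e))));
          assign_t I wb S t r' e x' }"

text \<open>
  The traversal provides what the remaining steps need to know about the tree. \<open>wb\<close>, \<open>L\<close>, \<open>S\<close> and \<open>t\<close>
  are the program's versions of \<^const>\<open>max_weight\<close>, of the cardinality of \<^const>\<open>leaves_below\<close>, of \<^const>\<open>gain\<close> and
  of \<^const>\<open>threshold\<close>. Only the cardinalities of the sets of leaves are computed, since listing the sets
  themselves can take quadratic time. The weight \<open>wb_total\<close> is computed but not used any further.
\<close>

definition algorithm_A :: "sdiptc \<Rightarrow> ((nat \<Rightarrow> real) \<times> real) timed" where
  "algorithm_A I =
     do { n \<leftarrow> step (size_of I);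
          N \<leftarrow> step (min (count_bound I) n);
          inc0 \<leftarrow> new_array n [];
          inc \<leftarrow> incidence_t (ends_of I) n inc0;
          st \<leftarrow> push_t (ends_of I) 0 0 (inc 0) [];
          bottom_up \<leftarrow> traverse_t (ends_of I) inc n st [];
          top_down \<leftarrow> rev_t bottom_up [];
          wb0 \<leftarrow> new_array n 0;
          wb \<leftarrow> max_weights_t I n wb0;
          wb_total \<leftarrow> tree_weight_t n inc top_down wb;
          cnt0 \<leftarrow> new_array n 0;
          L0 \<leftarrow> new_array n 0;
          L \<leftarrow> leaf_counts_t inc bottom_up cnt0 L0;
          S0 \<leftarrow> new_array n 0;
          S \<leftarrow> gains_t I L wb n S0;
          Ss \<leftarrow> to_list_t S n [];
          t \<leftarrow> select_t (N - 1) Ss;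
          above \<leftarrow> count_above_t S t n;
          x0 \<leftarrow> new_array n 0;
          x \<leftarrow> assign_t I wb S t (N - above) n x0;
          x_total \<leftarrow> tree_weight_t n inc top_down x;
          ret (x, x_total) }"

definition running_time :: "sdiptc \<Rightarrow> nat" where
  "running_time I = snd (algorithm_A I)"

end

theory Submission
  imports Defs
begin

text \<open>
  Exchanging the two summations shows that the sum of the root-leaf distances is linear in the
  weights, the coefficient of an edge being the number of leaves below it. So raising the weight of
  an edge as far as possible gains \<^const>\<open>gain\<close>, which is nonnegative, and the best choice is
  given by any \<open>N\<close> edges of largest gain. The leaf counts satisfy a recursion along the arcs of the
  tree; the traversal delivers every edge exactly once, away from the root, because an edge leading
  back to a node met before would close a cycle. The cost of the traversal is the sum of the
  degrees, which is at most \<open>2n\<close>. In the selection, three of the five elements of at least half of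
  the groups lie on either side of the pivot, so that each part has about \<open>7n/10\<close> elements at most;
  together with the \<open>n/5\<close> medians this stays below \<open>n\<close> by a constant factor.
\<close>

section \<open>Costs of the basic timed operations\<close>

lemma snd_simps [simp]:
  "snd (bind_timed m f) = snd m + snd (f (fst m))" "snd (step v) = 1" "snd (ret v) = 0"
  by (simp_all add: bind_timed_def step_def ret_def Let_def)

lemma fst_new_array [simp]: "fst (new_array n v) = (\<lambda>_. v)"
  and snd_new_array [simp]: "snd (new_array n v) = Suc n"
  by (simp_all add: new_array_def)

section \<open>Selection\<close>

lemma snd_length_t [simp]: "snd (length_t xs) = Suc (length xs)"
  by (induction xs) auto

lemma snd_nth_t: "snd (nth_t xs k) \<le> Suc (length xs)"
  by (induction xs k rule: nth_t.induct) auto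

lemma fst_rev_t [simp]: "fst (rev_t xs ys) = rev xs @ ys"
  by (induction xs ys rule: rev_t.induct) auto

lemma snd_rev_t [simp]: "snd (rev_t xs ys) = Suc (length xs)"
  by (induction xs ys rule: rev_t.induct) auto

lemma snd_insert_t: "snd (insert_t x ys) \<le> Suc (length ys)"
  by (induction ys) auto

text \<open>A quadratic bound suffices, since the program sorts only groups of five and lists of
  fewer than 100 elements.\<close>

lemma snd_sort_t: "snd (sort_t xs) \<le> (length xs + 1)\<^sup>2"
proof (induction xs)
  case (Cons x xs)
  have "snd (insert_t x (fst (sort_t xs))) \<le> Suc (length xs)"
    using snd_insert_t[of x "fst (sort_t xs)"] by (simp add: length_sort_t)
  with Cons show ?case by (simp add: power2_eq_square)
qed simp

lemma sorted_insert_t: "sorted_wrt (\<ge>) ys \<Longrightarrow> sorted_wrt (\<ge>) (fst (insert_t x ys))"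
proof (induction ys)
  case (Cons y ys)
  have "set (fst (insert_t x ys)) = insert x (set ys)"
    using mset_insert_t[of x ys] by (metis set_mset_add_mset_insert set_mset_mset)
  with Cons show ?case by force
qed simp

lemma fst_sort_t: "fst (sort_t xs) = rev (sort xs)"
proof -
  have "sorted_wrt (\<ge>) (fst (sort_t xs))"
    by (induction xs) (auto simp: sorted_insert_t)
  then have "sorted (rev (fst (sort_t xs)))"
    by (simp add: sorted_wrt_rev)
  then have "sort xs = rev (fst (sort_t xs))"
    by (intro properties_for_sort) (simp_all add: mset_sort_t)
  then show ?thesis by simp
qed

lemma snd_medians_t: "snd (medians_t xs) \<le> 9 * length xs + 1"
proof (induction xs rule: medians_t.induct)
  case (1 a b c d e xs)
  \<comment> \<open>Each group costs at most 36 + 6 + 1 = 43 steps, which its five elements pay for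
    at 9 steps each.\<close>
  have "snd (sort_t [a, b, c, d, e]) \<le> 36"
    using snd_sort_t[of "[a, b, c, d, e]"] by simp
  moreover have "snd (nth_t (fst (sort_t [a, b, c, d, e])) 2) \<le> 6"
    using snd_nth_t[of "fst (sort_t [a, b, c, d, e])" 2]
    by (simp add: length_sort_t del: sort_t.simps)
  moreover have "snd (medians_t xs) \<le> 9 * length xs + 1"
    using 1 by blast
  ultimately show ?case
    by (simp del: sort_t.simps)
qed auto

lemma snd_split_t: "snd (split_t p xs) = Suc (length xs)"
  by (induction xs) (auto split: prod.splits)

text \<open>
  \<open>kth_largest xs k v\<close> determines \<open>v\<close> uniquely, and in contrast to positions in a sorted list it can
  be transferred directly between a list and the parts into which a pivot divides it.
\<close>

definition kth_largest :: "real list \<Rightarrow> nat \<Rightarrow> real \<Rightarrow> bool" where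
  "kth_largest xs k v \<longleftrightarrow>
     length (filter (\<lambda>x. x > v) xs) \<le> k \<and> k < length (filter (\<lambda>x. x \<ge> v) xs)"

lemma length_filter_mono:
  assumes "\<And>x. x \<in> set xs \<Longrightarrow> P x \<Longrightarrow> Q x"
  shows "length (filter P xs) \<le> length (filter Q xs)"
  using assms by (induction xs) auto

text \<open>If \<open>u < u'\<close>, everything counted as \<open>>= u'\<close> is also counted as
  \<open>> u\<close>; the former count exceeds \<open>k\<close> while the latter does not.\<close>

lemma kth_largest_unique:
  assumes "kth_largest xs k v" "kth_largest xs k v'"
  shows "v = v'"
proof -
  have False if "u < u'" "kth_largest xs k u" "kth_largest xs k u'" for u u'
  proof -
    have "length (filter (\<lambda>x. x \<ge> u') xs) \<le> length (filter (\<lambda>x. x > u) xs)"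
      by (rule length_filter_mono) (use that(1) in auto)
    with that show False by (simp add: kth_largest_def)
  qed
  with assms show ?thesis by (meson linorder_neqE)
qed

text \<open>For a value outside the list the two counts in the definition coincide, leaving no room
  for \<open>k\<close>.\<close>

lemma kth_largest_in_set:
  assumes "kth_largest xs k v"
  shows "v \<in> set xs"
proof (rule ccontr)
  assume "v \<notin> set xs"
  then have "length (filter (\<lambda>x. x \<ge> v) xs) \<le> length (filter (\<lambda>x. x > v) xs)"
    by (intro length_filter_mono) (auto simp: order.order_iff_strict)
  with assms show False by (simp add: kth_largest_def)
qed

lemma kth_largest_cong_mset:
  assumes "mset xs = mset ys"
  shows "kth_largest xs k v \<longleftrightarrow> kth_largest ys k v"
  unfolding kth_largest_def using assms
  by (metis mset_filter size_mset)

text \<open>In descending order only positions before \<open>k\<close> can hold larger values, and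
  positions \<open>0\<close> to \<open>k\<close> all hold values at least as large. This links the
  counting notion to the sorted list in \<open>threshold\<close>.\<close>

lemma kth_largest_nth:
  assumes "k < length xs"
  shows "kth_largest xs k (rev (sort xs) ! k)"
proof -
  define ys where "ys = rev (sort xs)"
  have k: "k < length ys" using assms by (simp add: ys_def)
  have mono: "ys ! j \<le> ys ! i" if "i \<le> j" "j < length ys" for i j
    using that by (simp add: ys_def rev_nth sorted_nth_mono)
  have "{i. i < length ys \<and> ys ! i > ys ! k} \<subseteq> {..<k}"
    using mono k by (auto simp: not_le[symmetric])
  then have "card {i. i < length ys \<and> ys ! i > ys ! k} \<le> k"
    by (metis card_lessThan card_mono finite_lessThan)
  moreover have "{..k} \<subseteq> {i. i < length ys \<and> ys ! i \<ge> ys ! k}"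
    using mono k by auto
  then have "k < card {i. i < length ys \<and> ys ! i \<ge> ys ! k}"
    using card_mono[of "{i. i < length ys \<and> ys ! i \<ge> ys ! k}" "{..k}"] by simp
  ultimately have "kth_largest ys k (ys ! k)"
    by (simp add: kth_largest_def length_filter_conv_card)
  moreover have "mset ys = mset xs" by (simp add: ys_def)
  ultimately show ?thesis
    using kth_largest_cong_mset ys_def by blast
qed

declare select_t.simps [simp del]

text \<open>One unfolding for long lists, with the intermediate results named so that correctness
  and cost can both refer to them. The five linear passes (the lengths of \<open>xs\<close>,
  \<open>ms\<close>, \<open>gs\<close>, \<open>es\<close> and the split of \<open>xs\<close>)
  contribute the constant 5, one call on the empty list each.\<close>

lemma select_t_rec:
  fixes k xs
  defines "ms \<equiv> fst (medians_t xs)"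
  defines "p \<equiv> fst (select_t (length ms div 2) ms)"
  defines "gs \<equiv> filter (\<lambda>x. x > p) xs"
  defines "es \<equiv> filter (\<lambda>x. x = p) xs"
  defines "ls \<equiv> filter (\<lambda>x. x < p) xs"
  defines "res \<equiv> (if k < length gs then select_t k gs
           else if k < length gs + length es then step p
           else select_t (k - (length gs + length es)) ls)"
  assumes "100 \<le> length xs"
  shows "fst (select_t k xs) = fst res"
    and "snd (select_t k xs) = snd (medians_t xs) + snd (select_t (length ms div 2) ms)
       + 2 * length xs + length ms + length gs + length es + 5 + snd res"
proof -
  have s: "split_t p xs = ((gs, es, ls), Suc (length xs))"
    unfolding gs_def es_def ls_def by (metis fst_split_t snd_split_t prod.collapse)
  show "fst (select_t k xs) = fst res"
    using assms(7) s[unfolded p_def ms_def]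
    by (simp add: select_t.simps[of k xs] res_def p_def ms_def)
  show "snd (select_t k xs) = snd (medians_t xs) + snd (select_t (length ms div 2) ms)
       + 2 * length xs + length ms + length gs + length es + 5 + snd res"
    using assms(7) s[unfolded p_def ms_def]
    by (simp add: select_t.simps[of k xs] res_def p_def ms_def)
qed

lemma select_t_base:
  assumes "length xs < 100"
  shows "select_t k xs = do { n \<leftarrow> length_t xs; ys \<leftarrow> sort_t xs; nth_t ys k }"
  using assms by (subst select_t.simps) (simp add: bind_timed_def)

lemma kth_largest_select_t:
  "k < length xs \<Longrightarrow> kth_largest xs k (fst (select_t k xs))"
proof (induction "length xs" arbitrary: k xs rule: less_induct)
  case less
  show ?case
  proof (cases "length xs < 100")
    case True
    then show ?thesis
      using kth_largest_nth[OF less.prems] less.prems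
      by (simp add: select_t_base fst_sort_t fst_nth_t)
  next
    case False
    define ms where "ms = fst (medians_t xs)"
    define p where "p = fst (select_t (length ms div 2) ms)"
    define gs es ls where "gs = filter (\<lambda>x. x > p) xs"
      and "es = filter (\<lambda>x. x = p) xs" and "ls = filter (\<lambda>x. x < p) xs"
    have lens: "length gs + length es + length ls = length xs"
      unfolding gs_def es_def ls_def by (rule length_filter_split)
    \<comment> \<open>The pivot occurs in \<open>xs\<close>, so both strict parts omit an element
      and the induction hypothesis applies to them.\<close>
    have "kth_largest ms (length ms div 2) p"
      unfolding p_def using False by (intro less.hyps) (auto simp: ms_def length_medians_t)
    then have "p \<in> set ms"
      by (rule kth_largest_in_set)
    then have p: "p \<in> set xs"
      using set_medians_t ms_def by blast
    note rec = select_t_rec(1)[of xs k, folded ms_def, folded p_def, folded gs_def es_def ls_def]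
    have ge: "length (filter (\<lambda>x. x \<ge> p) xs) = length gs + length es"
      unfolding gs_def es_def by (induction xs) auto
    consider "k < length gs" | "length gs \<le> k" "k < length gs + length es"
      | "length gs + length es \<le> k" by linarith
    then show ?thesis
    proof cases
      case 1
      define v where "v = fst (select_t k gs)"
      have kth: "kth_largest gs k v"
        unfolding v_def using p 1 by (intro less.hyps) (auto simp: gs_def intro!: length_filter_less)
      then have "v \<in> set gs" by (rule kth_largest_in_set)
      then have "v > p" by (simp add: gs_def)
      note kth
      \<comment> \<open>Since \<open>v\<close> lies above the pivot, the discarded elements pass
        neither filter.\<close>
      moreover have "filter (\<lambda>x. x > v) gs = filter (\<lambda>x. x > v) xs"
        "filter (\<lambda>x. x \<ge> v) gs = filter (\<lambda>x. x \<ge> v) xs"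
        unfolding gs_def filter_filter using \<open>v > p\<close> by (auto intro!: filter_cong)
      ultimately show ?thesis
        using rec False 1 by (simp add: kth_largest_def v_def)
    next
      case 2
      then show ?thesis
        using rec False ge by (simp add: kth_largest_def gs_def)
    next
      case 3
      define j where "j = k - (length gs + length es)"
      have j: "j < length ls" using 3 lens less.prems by (simp add: j_def)
      define v where "v = fst (select_t j ls)"
      have kth: "kth_largest ls j v"
        unfolding v_def using p j by (intro less.hyps) (auto simp: ls_def intro!: length_filter_less)
      then have "v \<in> set ls" by (rule kth_largest_in_set)
      then have "v < p" by (simp add: ls_def)
      note kth
      \<comment> \<open>All of \<open>gs\<close> and \<open>es\<close> lie above \<open>v\<close>,
        so both counts grow by their number, which is what \<open>j\<close> subtracts from
        \<open>k\<close>.\<close>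
      moreover have "length (filter (\<lambda>x. x > v) xs) = length gs + length es + length (filter (\<lambda>x. x > v) ls)"
        "length (filter (\<lambda>x. x \<ge> v) xs) = length gs + length es + length (filter (\<lambda>x. x \<ge> v) ls)"
        unfolding gs_def es_def ls_def using \<open>v < p\<close> by (induction xs) auto
      ultimately have "kth_largest xs k v"
        using 3 unfolding kth_largest_def j_def by linarith
      then show ?thesis
        using rec False 3 by (simp add: v_def j_def)
    qed
  qed
qed

corollary fst_select_t: "k < length xs \<Longrightarrow> fst (select_t k xs) = rev (sort xs) ! k"
  using kth_largest_unique kth_largest_select_t kth_largest_nth by blast

text \<open>\<open>P\<close> is upward or downward closed. A group median satisfying
  \<open>P\<close> therefore brings along the two elements on the matching side of its sorted group,
  and the groups are disjoint parts of the list.\<close>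

lemma length_filter_medians_t:
  fixes P :: "real \<Rightarrow> bool"
  assumes "(\<forall>x y. x \<le> y \<longrightarrow> P x \<longrightarrow> P y) \<or> (\<forall>x y. x \<le> y \<longrightarrow> P y \<longrightarrow> P x)"
  shows "3 * length (filter P (fst (medians_t xs))) \<le> length (filter P xs)"
proof (induction xs rule: medians_t.induct)
  case (1 a b c d e xs)
  define ys where "ys = fst (sort_t [a, b, c, d, e])"
  have len: "length ys = 5" by (simp add: ys_def length_sort_t del: sort_t.simps)
  have mono: "ys ! j \<le> ys ! i" if "i \<le> j" "j < length ys" for i j
    using that unfolding ys_def fst_sort_t by (simp add: rev_nth sorted_nth_mono)
  have "3 \<le> length (filter P ys)" if "P (ys ! 2)"
  proof -
    obtain I where I: "I \<subseteq> {i. i < length ys \<and> P (ys ! i)}" "card I = 3"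
      using assms
    proof
      assume up: "\<forall>x y. x \<le> y \<longrightarrow> P x \<longrightarrow> P y"
      show thesis
        by (rule that[of "{0, 1, 2}"]) (use up mono[of 0 2] mono[of 1 2] len \<open>P (ys ! 2)\<close> in auto)
    next
      assume down: "\<forall>x y. x \<le> y \<longrightarrow> P y \<longrightarrow> P x"
      show thesis
        by (rule that[of "{2, 3, 4}"]) (use down mono[of 2 3] mono[of 2 4] len \<open>P (ys ! 2)\<close> in auto)
    qed
    then show ?thesis
      using card_mono[OF _ I(1)] by (simp add: length_filter_conv_card)
  qed
  moreover have "length (filter P ys) = length (filter P [a, b, c, d, e])"
    using mset_sort_t[of "[a, b, c, d, e]"] unfolding ys_def by (metis mset_filter size_mset)
  moreover have "length (filter P (a # b # c # d # e # xs))
      = length (filter P [a, b, c, d, e]) + length (filter P xs)"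
    by simp
  moreover have "fst (medians_t (a # b # c # d # e # xs)) = ys ! 2 # fst (medians_t xs)"
    using len by (simp add: ys_def fst_nth_t del: sort_t.simps)
  moreover have "3 * length (filter P (fst (medians_t xs))) \<le> length (filter P xs)"
    using 1 by blast
  ultimately show ?case
    by (cases "P (ys ! 2)") (simp_all del: medians_t.simps)
qed auto

text \<open>The constant 10200 covers a short list: at most 10000 for sorting and 100 each for the
  length and the lookup. In the recursive case the two calls together handle about
  \<open>9 * n / 10\<close> elements; the slope 1200 makes the saved tenth pay for the linear passes
  and for the second additive constant.\<close>

lemma snd_select_t: "k < length xs \<Longrightarrow> snd (select_t k xs) \<le> 1200 * length xs + 10200"
proof (induction "length xs" arbitrary: k xs rule: less_induct)
  case less
  define n where "n = length xs"
  show ?case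
  proof (cases "n < 100")
    case True
    have "snd (sort_t xs) \<le> 10000"
      using snd_sort_t[of xs] power_mono[of "length xs + 1" 100 2] True by (simp add: n_def)
    moreover have "snd (nth_t (fst (sort_t xs)) k) \<le> 100"
      using snd_nth_t[of "fst (sort_t xs)" k] True by (simp add: length_sort_t n_def)
    ultimately show ?thesis
      using True by (simp add: select_t_base n_def)
  next
    case False
    define ms where "ms = fst (medians_t xs)"
    define p where "p = fst (select_t (length ms div 2) ms)"
    define gs es ls where "gs = filter (\<lambda>x. x > p) xs"
      and "es = filter (\<lambda>x. x = p) xs" and "ls = filter (\<lambda>x. x < p) xs"
    have lens: "length gs + length es + length ls = n"
      unfolding gs_def es_def ls_def n_def by (rule length_filter_split)
    define q where "q = length ms"
    have q: "q = n div 5" by (simp add: q_def ms_def n_def length_medians_t)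
    have q20: "20 \<le> q" using False q by simp
    have kth: "kth_largest ms (q div 2) p"
      unfolding p_def q_def using q20 by (intro kth_largest_select_t) (auto simp: q_def)
    \<comment> \<open>At most \<open>q div 2\<close> medians exceed the pivot. Each of the others
      stands for three elements of \<open>xs\<close> that do not enter \<open>gs\<close>.\<close>
    have "length (filter (\<lambda>x. x > p) ms) + length (filter (\<lambda>x. x \<le> p) ms) = q"
      unfolding q_def by (induction ms) auto
    then have "q - q div 2 \<le> length (filter (\<lambda>x. x \<le> p) ms)"
      using kth unfolding kth_largest_def by linarith
    moreover have "3 * length (filter (\<lambda>x. x \<le> p) ms) \<le> length (filter (\<lambda>x. x \<le> p) xs)"
      unfolding ms_def by (rule length_filter_medians_t) auto
    moreover have "length (filter (\<lambda>x. x \<le> p) xs) + length gs = n"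
      unfolding gs_def n_def by (induction xs) auto
    ultimately have gs: "length gs + 3 * (q - q div 2) \<le> n" by linarith
    \<comment> \<open>On the other side, \<open>q div 2 + 1\<close> is at least the rounded-up half
      \<open>q - q div 2\<close>, so \<open>ls\<close> obeys the same bound as
      \<open>gs\<close>.\<close>
    have "q div 2 + 1 \<le> length (filter (\<lambda>x. x \<ge> p) ms)"
      using kth by (simp add: kth_largest_def)
    moreover have "3 * length (filter (\<lambda>x. x \<ge> p) ms) \<le> length (filter (\<lambda>x. x \<ge> p) xs)"
      unfolding ms_def by (rule length_filter_medians_t) auto
    moreover have "length (filter (\<lambda>x. x \<ge> p) xs) + length ls = n"
      unfolding ls_def n_def by (induction xs) auto
    ultimately have ls: "length ls + 3 * (q - q div 2) \<le> n" by linarith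
    have IH: "snd (select_t j ys) \<le> 1200 * length ys + 10200"
      if "length ys < n" "j < length ys" for j ys
      using less.hyps that by (simp add: n_def)
    define res where "res = (if k < length gs then select_t k gs
           else if k < length gs + length es then step p
           else select_t (k - (length gs + length es)) ls)"
    have "snd res \<le> 1200 * (n - 3 * (q - q div 2)) + 10200"
    proof -
      have "snd (select_t j ys) \<le> 1200 * (n - 3 * (q - q div 2)) + 10200"
        if "length ys + 3 * (q - q div 2) \<le> n" "j < length ys" for j ys
        using IH[of ys j] that q20 by linarith
      then show ?thesis
        unfolding res_def using gs ls lens less.prems by (auto simp: n_def)
    qed
    moreover have "snd (select_t (q div 2) ms) \<le> 1200 * q + 10200"
      using IH[of ms "q div 2"] q q20 by (simp add: q_def)
    moreover have "snd (medians_t xs) \<le> 9 * n + 1"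
      unfolding n_def by (rule snd_medians_t)
    moreover have "snd (select_t k xs) = snd (medians_t xs) + snd (select_t (q div 2) ms)
       + 2 * n + q + length gs + length es + 5 + snd res"
      using select_t_rec(2)[of xs k, folded ms_def, folded p_def, folded gs_def es_def ls_def,
          folded res_def q_def n_def] False by (simp add: q_def)
    \<comment> \<open>The sizes of the two calls add up to at most \<open>n - q / 2\<close>, which
      saves \<open>600 * q\<close> steps. As \<open>n <= 5 * q + 4\<close> and
      \<open>q >= 20\<close>, this covers \<open>14 * n\<close> and the excess constant 20500 -
      10200.\<close>
    moreover have "1200 * (n - 3 * (q - q div 2)) + 1200 * q + 14 * n + 20500 \<le> 1200 * n + 10200"
    proof -
      obtain d where d: "d = q - q div 2" by simp
      have "n \<le> 5 * q + 4" "5 * q \<le> n" "q \<le> 2 * d" using q d by linarith+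
      with q20 gs show ?thesis unfolding d[symmetric] by linarith
    qed
    ultimately show ?thesis
      using lens q by (simp add: n_def)
  qed
qed

section \<open>Walks and paths\<close>

lemma walk_append: "walk n ends a (p @ q) c \<longleftrightarrow> (\<exists>b. walk n ends a p b \<and> walk n ends b q c)"
  by (induction p arbitrary: a) auto

lemma walk_snoc:
  "walk n ends a (p @ [(e, c)]) b \<longleftrightarrow>
     c = b \<and> e \<in> edges n \<and> (\<exists>v. walk n ends a p v \<and> joins ends e v c)"
  by (auto simp: walk_append)

lemma joins_sym: "joins ends e a b \<longleftrightarrow> joins ends e b a"
  by (auto simp: joins_def)

lemma joins_cases: "joins ends e a b \<Longrightarrow> joins ends e c d \<Longrightarrow> a = c \<and> b = d \<or> a = d \<and> b = c"
  by (auto simp: joins_def)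

lemma incident_joins: "e \<in> edges n \<Longrightarrow> joins ends e a b \<Longrightarrow> e \<in> incident n ends a"
  by (auto simp: joins_def incident_def)

lemma joins_opposite: "e \<in> incident n ends a \<Longrightarrow> joins ends e a (opposite ends e a)"
  by (cases "ends e") (auto simp: joins_def incident_def opposite_def)

lemma walk_reverse:
  "walk n ends a p b \<Longrightarrow> \<exists>q. walk n ends b q a \<and> fst ` set q = fst ` set p"
proof (induction p arbitrary: a)
  case (Cons s p)
  obtain e v where s: "s = (e, v)" by (cases s)
  with Cons.prems have "walk n ends v p b" by simp
  then obtain q where q: "walk n ends b q v" "fst ` set q = fst ` set p"
    using Cons.IH by blast
  have "walk n ends b (q @ [(e, a)]) a"
    using Cons.prems s q(1) joins_sym by (auto simp: walk_snoc)
  moreover have "fst ` set (q @ [(e, a)]) = fst ` set (s # p)"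
    using q(2) s by auto
  ultimately show ?case by blast
qed auto

lemma walk_end: "walk n ends a p b \<Longrightarrow> b \<in> set (a # map snd p)"
  by (induction p arbitrary: a) force+

lemma walk_edge_ends:
  "walk n ends a p b \<Longrightarrow> e \<in> fst ` set p \<Longrightarrow> joins ends e c d \<Longrightarrow> c \<in> set (a # map snd p)"
proof (induction p arbitrary: a)
  case (Cons s p)
  obtain f v where s: "s = (f, v)" by (cases s)
  show ?case
  proof (cases "e = f")
    case True
    then show ?thesis
      using Cons.prems s joins_cases[of ends e c d a v] by auto
  next
    case False
    then show ?thesis
      using Cons s by auto
  qed
qed simp

text \<open>Cutting out detours only discards edges, so a walk avoiding some edge yields a path
  avoiding it. Distinct edges are recorded as well because \<open>cycle\<close> asks for
  them.\<close>

lemma walk_imp_path: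
  "walk n ends a p b \<Longrightarrow> \<exists>q. path n ends a q b \<and> distinct (map fst q) \<and> fst ` set q \<subseteq> fst ` set p"
proof (induction p arbitrary: a)
  case Nil
  then show ?case by (auto simp: path_def intro!: exI[of _ "[]"])
next
  case (Cons s p)
  obtain e v where s: "s = (e, v)" by (cases s)
  with Cons.prems have "walk n ends v p b" by simp
  then obtain q where q: "walk n ends v q b" "distinct (v # map snd q)"
    "distinct (map fst q)" "fst ` set q \<subseteq> fst ` set p"
    using Cons.IH unfolding path_def by blast
  have e: "e \<in> edges n" "joins ends e a v" using Cons.prems s by auto
  show ?case
  proof (cases "a \<in> set (v # map snd q)")
    case False
    then have "e \<notin> fst ` set q"
      using walk_edge_ends[OF q(1)] e(2) by blast
    then have "path n ends a ((e, v) # q) b \<and> distinct (map fst ((e, v) # q)) \<and>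
        fst ` set ((e, v) # q) \<subseteq> fst ` set (s # p)"
      using False q e s by (auto simp: path_def)
    then show ?thesis by blast
  next
    case True
    \<comment> \<open>Either the first step is a loop, or the shortened walk returns to
      \<open>a\<close>; in both cases what follows the return is a path.\<close>
    then consider "a = v" | f where "(f, a) \<in> set q" by auto
    then show ?thesis
    proof cases
      case 1
      then have "path n ends a q b" using q by (simp add: path_def)
      then show ?thesis using q by auto
    next
      case 2
      then obtain q1 q2 where q12: "q = q1 @ (f, a) # q2" by (meson split_list)
      then have "path n ends a q2 b"
        using q by (auto simp: path_def walk_append)
      then show ?thesis using q q12 by auto
    qed
  qed
qed

section \<open>Traversing a tree\<close>

abbreviation parent :: "arc \<Rightarrow> nat" where "parent a \<equiv> fst a"
abbreviation edge :: "arc \<Rightarrow> nat" where "edge a \<equiv> fst (snd a)"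
abbreviation child :: "arc \<Rightarrow> nat" where "child a \<equiv> snd (snd a)"

definition reached :: "arc list \<Rightarrow> nat set" where
  "reached as = insert 0 (child ` set as)"

lemma reached_simps [simp]:
  "reached [] = {0}" "reached (a # as) = insert (child a) (reached as)"
  by (auto simp: reached_def)

text \<open>The arcs are listed in the order opposite to that in which the tree grows from the root.\<close>

fun grown :: "nat \<Rightarrow> graph \<Rightarrow> arc list \<Rightarrow> bool" where
  "grown n ends [] \<longleftrightarrow> True"
| "grown n ends ((v, e, x) # as) \<longleftrightarrow>
     grown n ends as \<and> e \<in> edges n \<and> joins ends e v x \<and>
     v \<in> reached as \<and> x \<notin> reached as \<and> e \<notin> edge ` set as"

lemma grown_append: "grown n ends (bs @ as) \<Longrightarrow> grown n ends as"
  by (induction bs) auto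

lemma grown_arc:
  "grown n ends as \<Longrightarrow> (v, e, x) \<in> set as \<Longrightarrow>
     e \<in> edges n \<and> joins ends e v x \<and> v \<in> reached as \<and> x \<noteq> 0 \<and> x \<noteq> v"
  by (induction n ends as rule: grown.induct) (auto simp: reached_def)

lemma grown_distinct:
  "grown n ends as \<Longrightarrow> distinct (map edge as) \<and> distinct (map child as)"
  by (induction n ends as rule: grown.induct) (auto simp: reached_def image_iff)

lemma grown_walk:
  "grown n ends as \<Longrightarrow> y \<in> reached as \<Longrightarrow> \<exists>p. walk n ends 0 p y \<and> fst ` set p \<subseteq> edge ` set as"
proof (induction n ends as arbitrary: y rule: grown.induct)
  case (1 n ends)
  then show ?case by (auto intro!: exI[of _ "[]"])
next
  case (2 n ends v e x as)
  then have IH: "\<exists>p. walk n ends 0 p z \<and> fst ` set p \<subseteq> edge ` set as" if "z \<in> reached as" for z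
    using that by simp
  show ?case
  proof (cases "y = x")
    case True
    have "v \<in> reached as" using 2(2) by simp
    then obtain p where "walk n ends 0 p v" "fst ` set p \<subseteq> edge ` set as"
      using IH by blast
    with 2(2) True show ?thesis
      by (intro exI[of _ "p @ [(e, x)]"]) (auto simp: walk_snoc)
  next
    case False
    then have "y \<in> reached as" using 2(3) by simp
    then obtain p where "walk n ends 0 p y" "fst ` set p \<subseteq> edge ` set as"
      using IH by blast
    then show ?thesis by auto
  qed
qed

text \<open>The traversal invariant: \<open>acc\<close> holds the arcs already delivered and
  \<open>st\<close> those still waiting, whose parents are reached. Distinctness ranges over both
  lists and includes the root, so a popped arc always leads to a new node.\<close>

definition frontier :: "nat \<Rightarrow> graph \<Rightarrow> arc list \<Rightarrow> arc list \<Rightarrow> bool" where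
  "frontier n ends acc st \<longleftrightarrow>
     grown n ends acc \<and>
     (\<forall>(v, e, x)\<in>set st. v \<in> reached acc \<and> e \<in> edges n \<and> joins ends e v x) \<and>
     distinct (map edge (st @ acc)) \<and> distinct (0 # map child (st @ acc))"

lemma frontier_arc:
  assumes "frontier n ends acc st" "(v, e, x) \<in> set (st @ acc)"
  shows "e \<in> edges n" "joins ends e v x" "v \<in> reached acc"
  using assms grown_arc[of n ends acc v e x] by (auto simp: frontier_def)

lemma frontier_walk:
  assumes "frontier n ends acc st" "y \<in> reached (st @ acc)"
  obtains p where "walk n ends 0 p y" "fst ` set p \<subseteq> edge ` set (st @ acc)"
proof (cases "y \<in> reached acc")
  case True
  then obtain p where "walk n ends 0 p y" "fst ` set p \<subseteq> edge ` set acc"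
    using assms grown_walk unfolding frontier_def by blast
  then show ?thesis using that[of p] by auto
next
  case False
  then obtain v e where a: "(v, e, y) \<in> set st"
    using assms(2) by (auto simp: reached_def)
  then have "e \<in> edges n" "joins ends e v y" "v \<in> reached acc"
    using frontier_arc[OF assms(1), of v e y] by auto
  moreover from this obtain p where "walk n ends 0 p v" "fst ` set p \<subseteq> edge ` set acc"
    using assms grown_walk unfolding frontier_def by blast
  ultimately show ?thesis
    using that[of "p @ [(e, y)]"] a by (force simp: walk_snoc)
qed

lemma frontier_pop:
  assumes "frontier n ends acc (a # st)"
  shows "frontier n ends (a # acc) st"
proof -
  obtain v e x where a: "a = (v, e, x)" by (cases a)
  have "x \<notin> reached acc" "e \<notin> edge ` set acc"
    using assms a by (auto simp: frontier_def reached_def)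
  then have "grown n ends (a # acc)"
    using assms a by (auto simp: frontier_def)
  moreover have "distinct (map edge (st @ a # acc))" "distinct (0 # map child (st @ a # acc))"
    using assms by (auto simp: frontier_def)
  ultimately show ?thesis
    using assms by (auto simp: frontier_def)
qed

locale tree_graph =
  fixes n :: nat and ends :: graph
  assumes tree: "is_tree n ends"
begin

lemma ends_in_nodes: "e \<in> edges n \<Longrightarrow> joins ends e a b \<Longrightarrow> a \<in> nodes n"
  using tree by (force simp: is_tree_def joins_def)

text \<open>Shortening the walk to a path makes its edges distinct while still avoiding
  \<open>f\<close>, which then completes a cycle. The empty walk covers loops.\<close>

lemma no_closing_edge:
  assumes "walk n ends a p b" "f \<in> edges n" "joins ends f b a" "f \<notin> fst ` set p"
  shows False
proof -
  obtain q where q: "path n ends a q b" "distinct (map fst q)" "fst ` set q \<subseteq> fst ` set p"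
    using walk_imp_path[OF assms(1)] by blast
  have "cycle n ends a (q @ [(f, a)])"
    unfolding cycle_def using assms q by (auto simp: walk_snoc path_def)
  moreover have "a \<in> nodes n"
    using assms(2,3) ends_in_nodes[of f a b] joins_sym[of ends f a b] by blast
  ultimately show False using tree by (auto simp: is_tree_def)
qed

lemma no_loop: "e \<in> edges n \<Longrightarrow> fst (ends e) \<noteq> snd (ends e)"
  using no_closing_edge[of "fst (ends e)" "[]" "fst (ends e)" e]
  by (auto simp: joins_def prod_eq_iff)

text \<open>Were \<open>z\<close> already reached or waiting, the walk from \<open>x\<close> back to
  the root followed by one from the root to \<open>z\<close> would use listed edges only, and
  \<open>f\<close> would close a cycle.\<close>

lemma frontier_push:
  assumes "frontier n ends acc st" "x \<in> reached acc" "f \<in> edges n" "joins ends f x z"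
    and "f \<notin> edge ` set (st @ acc)"
  shows "frontier n ends acc ((x, f, z) # st)"
proof -
  have "z \<notin> reached (st @ acc)"
  proof
    assume "z \<in> reached (st @ acc)"
    then obtain p where p: "walk n ends 0 p z" "fst ` set p \<subseteq> edge ` set (st @ acc)"
      using frontier_walk assms(1) by blast
    have "x \<in> reached (st @ acc)" using assms(2) by (auto simp: reached_def)
    then obtain q where "walk n ends 0 q x" "fst ` set q \<subseteq> edge ` set (st @ acc)"
      using frontier_walk assms(1) by blast
    then obtain q' where q': "walk n ends x q' 0" "fst ` set q' \<subseteq> edge ` set (st @ acc)"
      using walk_reverse[of n ends 0 q x] by auto
    have "walk n ends x (q' @ p) z" using p q' by (auto simp: walk_append)
    moreover have "f \<notin> fst ` set (q' @ p)" using p q' assms(5) by auto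
    moreover have "joins ends f z x" using assms(4) joins_sym[of ends f x z] by simp
    ultimately show False using no_closing_edge assms(3) by blast
  qed
  then have "z \<noteq> 0" "z \<notin> child ` set (st @ acc)"
    by (auto simp: reached_def)
  then have "distinct (0 # map child (((x, f, z) # st) @ acc))"
    using assms(1) by (auto simp: frontier_def)
  moreover have "distinct (map edge (((x, f, z) # st) @ acc))"
    using assms(1,5) by (auto simp: frontier_def)
  ultimately show ?thesis
    using assms(1-4) unfolding frontier_def by simp
qed

lemma frontier_push_t:
  assumes "frontier n ends acc st" "x \<in> reached acc" "set fs \<subseteq> incident n ends x" "distinct fs"
    and "\<And>f. f \<in> set fs \<Longrightarrow> f \<noteq> e \<Longrightarrow> f \<notin> edge ` set (st @ acc)"
  shows "frontier n ends acc (fst (push_t ends e x fs st)) \<and>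
    edge ` set (fst (push_t ends e x fs st)) = edge ` set st \<union> (set fs - {e})"
  using assms
proof (induction fs arbitrary: st)
  case (Cons f fs)
  show ?case
  proof (cases "f = e")
    case True
    then show ?thesis using Cons by auto
  next
    case False
    have f: "f \<in> edges n" "joins ends f x (opposite ends f x)"
      using Cons.prems(3) joins_opposite by (auto simp: incident_def)
    have "frontier n ends acc ((x, f, opposite ends f x) # st)"
      using Cons.prems f False by (intro frontier_push) auto
    then have "frontier n ends acc (fst (push_t ends e x fs ((x, f, opposite ends f x) # st))) \<and>
        edge ` set (fst (push_t ends e x fs ((x, f, opposite ends f x) # st)))
          = edge ` set ((x, f, opposite ends f x) # st) \<union> (set fs - {e})"
      by (rule Cons.IH) (use Cons.prems in auto)
    then show ?thesis using False by auto
  qed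
qed auto

text \<open>By connectedness every node has a walk from the root. Each of its edges starts at a
  reached node and so is listed, and both ends of a listed arc are reached.\<close>

lemma reached_closed:
  assumes "\<And>y. y \<in> reached as \<Longrightarrow> incident n ends y \<subseteq> edge ` set as"
    and "\<And>v e x. (v, e, x) \<in> set as \<Longrightarrow> joins ends e v x \<and> v \<in> reached as"
  shows "nodes n \<subseteq> reached as"
proof
  have *: "b \<in> reached as" if "walk n ends a p b" "a \<in> reached as" for a b p
    using that
  proof (induction p arbitrary: a)
    case (Cons s p)
    obtain f w where s: "s = (f, w)" by (cases s)
    have f: "f \<in> edges n" "joins ends f a w" using Cons.prems s by auto
    then have "f \<in> edge ` set as"
      using assms(1) Cons.prems(2) incident_joins by blast
    then obtain v x where "(v, f, x) \<in> set as" by auto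
    moreover from this have "x \<in> reached as" by (force simp: reached_def)
    ultimately have "w \<in> reached as"
      using assms(2) f joins_cases[of ends f a w v x] by metis
    then show ?case using Cons s by auto
  qed auto
  fix b assume "b \<in> nodes n"
  then obtain p where "walk n ends 0 p b"
    using tree by (force simp: is_tree_def nodes_def)
  then show "b \<in> reached as" using * by (auto simp: reached_def)
qed

text \<open>The equation \<open>length acc + k = n\<close> says that the remaining iterations match
  the number of arcs still missing, so the iteration bound never cuts the traversal short.\<close>

lemma traverse_t_grown:
  assumes inc: "\<And>x. set (inc x) = incident n ends x \<and> distinct (inc x)"
  shows "frontier n ends acc st \<Longrightarrow>
    (\<And>y. y \<in> reached acc \<Longrightarrow> incident n ends y \<subseteq> edge ` set (st @ acc)) \<Longrightarrow>
    length acc + k = n \<Longrightarrow> as = fst (traverse_t ends inc k st acc) \<Longrightarrow>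
    grown n ends as \<and> edge ` set as = edges n"
proof (induction k arbitrary: acc st)
  case 0
  have g: "grown n ends acc" using 0 by (simp add: frontier_def)
  have "card (edge ` set acc) = n"
    using grown_distinct[OF g] 0(3) distinct_card[of "map edge acc"] by simp
  moreover have "edge ` set acc \<subseteq> edges n" using grown_arc[OF g] by auto
  ultimately have "edge ` set acc = edges n"
    by (intro card_subset_eq) (auto simp: edges_def)
  then show ?case using g 0 by simp
next
  case (Suc k)
  show ?case
  proof (cases st)
    case Nil
    note prems = Suc.prems[unfolded Nil]
    have g: "grown n ends acc" using prems(1) by (simp add: frontier_def)
    \<comment> \<open>With an empty stack, every edge at a reached node has been delivered.\<close>
    have closed: "incident n ends y \<subseteq> edge ` set acc" if "y \<in> reached acc" for y
      using prems(2)[OF that] by simp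
    have "nodes n \<subseteq> reached acc"
      by (rule reached_closed, rule closed) (use grown_arc[OF g] in blast)+
    moreover have "e \<in> edge ` set acc" if "fst (ends e) \<in> reached acc" "e \<in> edges n" for e
      using prems(2)[OF that(1)] that(2) by (auto simp: incident_def)
    ultimately have "edges n \<subseteq> edge ` set acc"
      using tree_graph.tree[OF tree_graph_axioms] by (auto simp: is_tree_def)
    moreover have "edge ` set acc \<subseteq> edges n" using grown_arc[OF g] by auto
    ultimately show ?thesis using g prems by simp
  next
    case (Cons a0 st0)
    obtain v e x where a0: "a0 = (v, e, x)" by (cases a0)
    note prems = Suc.prems[unfolded Cons a0]
    define a where "a = (v, e, x)"
    have fr: "frontier n ends (a # acc) st0"
      unfolding a_def using prems(1) by (rule frontier_pop)
    \<comment> \<open>An edge listed with \<open>x\<close> as parent would mean that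
      \<open>x\<close> was reached before; listed with \<open>x\<close> as child, its arc would be
      the one just popped.\<close>
    have new: "f \<notin> edge ` set (st0 @ a # acc)" if f: "f \<in> incident n ends x" "f \<noteq> e" for f
    proof
      assume "f \<in> edge ` set (st0 @ a # acc)"
      then obtain v' x' where a': "(v', f, x') \<in> set (st0 @ a # acc)"
        by (fastforce simp del: set_append)
      then have a'': "(v', f, x') \<in> set (((v, e, x) # st0) @ acc)" by (auto simp: a_def)
      note arc = frontier_arc[OF prems(1) a'']
      have dist: "distinct (0 # map child ((a # st0) @ acc))"
        using prems(1) by (simp add: frontier_def a_def)
      have "joins ends f x (opposite ends f x)" using f(1) joins_opposite by blast
      then have "x = v' \<or> x = x'" using arc(2) joins_cases by blast
      then show False
      proof
        assume "x = v'"
        moreover have "x \<notin> reached acc" using dist by (auto simp: reached_def a_def)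
        ultimately show False using arc(3) by simp
      next
        assume "x = x'"
        moreover have "inj_on child (set (((v, e, x) # st0) @ acc))"
          using dist unfolding a_def distinct.simps distinct_map by blast
        ultimately have "(v', f, x') = (v, e, x)"
          using a'' by (elim inj_onD) auto
        then show False using f(2) by simp
      qed
    qed
    define st' where "st' = fst (push_t ends e x (inc x) st0)"
    have st': "frontier n ends (a # acc) st' \<and> edge ` set st' = edge ` set st0 \<union> (set (inc x) - {e})"
      unfolding st'_def using fr inc new
      by (intro frontier_push_t) (auto simp: a_def)
    have "incident n ends y \<subseteq> edge ` set (st' @ a # acc)"
        if "y \<in> reached (a # acc)" for y
    proof (cases "y = x")
      case True
      then show ?thesis using st' inc by (auto simp: a_def)
    next
      case False
      then have "incident n ends y \<subseteq> edge ` set ((a # st0) @ acc)"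
        using prems(2) that by (simp add: a_def)
      then show ?thesis using st' by (auto simp: image_Un)
    qed
    then show ?thesis
      using Suc.IH[of "a # acc" st'] prems(3,4) st' by (simp add: a_def st'_def)
  qed
qed

end

section \<open>Paths, leaf counts and distances in terms of the arc list\<close>

definition arcs_from :: "arc list \<Rightarrow> nat \<Rightarrow> arc set" where
  "arcs_from as x = {a \<in> set as. parent a = x}"

lemma finite_arcs_from [simp]: "finite (arcs_from as x)"
  by (rule finite_subset[of _ "set as"]) (auto simp: arcs_from_def)

locale rooted_tree = tree_graph +
  fixes as :: "arc list"
  assumes grown: "grown n ends as" and edge_arcs: "edge ` set as = edges n"
begin

lemma arc:
  assumes "(v, e, x) \<in> set as"
  shows "e \<in> edges n" "joins ends e v x" "v \<in> reached as" "x \<noteq> 0" "x \<noteq> v"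
  using grown_arc[OF grown assms] by auto

lemma arc_cong:
  assumes "a \<in> set as" "b \<in> set as" "edge a = edge b \<or> child a = child b"
  shows "a = b"
  using assms grown_distinct[OF grown] unfolding distinct_map inj_on_def by blast

lemma reached_arcs: "reached as = nodes n"
proof
  have "v \<in> nodes n \<and> x \<in> nodes n" if "(v, e, x) \<in> set as" for v e x
    using ends_in_nodes[of e v x] ends_in_nodes[of e x v] arc[OF that] joins_sym[of ends e v x] by simp
  then show "reached as \<subseteq> nodes n" by (auto simp: reached_def nodes_def)
  show "nodes n \<subseteq> reached as"
  proof (rule reached_closed)
    show "incident n ends y \<subseteq> edge ` set as" for y
      using edge_arcs by (auto simp: incident_def)
  qed (use arc in blast)
qed

text \<open>Parents precede their children in the order of growth, so a property can be carried down
  from the root.\<close>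

lemma node_induct [consumes 1, case_names root arc]:
  assumes "y \<in> nodes n" "P 0" "\<And>v e x. (v, e, x) \<in> set as \<Longrightarrow> v \<in> nodes n \<Longrightarrow> P v \<Longrightarrow> P x"
  shows "P y"
proof -
  \<comment> \<open>Generalised to every grown list with arcs in \<open>as\<close>, since removing
    the head of such a list leaves another one.\<close>
  have "y \<in> reached bs \<Longrightarrow> P y" if "grown n ends bs" "set bs \<subseteq> set as" for bs y
    using that
  proof (induction bs arbitrary: y)
    case Nil
    then show ?case using assms(2) by simp
  next
    case (Cons a bs)
    obtain v e x where a: "a = (v, e, x)" by (cases a)
    have IH: "z \<in> reached bs \<Longrightarrow> P z" for z
      using Cons.IH[of z] Cons.prems a by simp
    moreover have "v \<in> reached bs" "(v, e, x) \<in> set as"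
      using Cons.prems a by auto
    moreover from this have "v \<in> nodes n" using arc(3) reached_arcs by blast
    ultimately have "P x" using assms(3) by blast
    then show ?case using IH Cons.prems(1) a by auto
  qed
  then show ?thesis using grown assms(1) reached_arcs by blast
qed

text \<open>A path from the root never turns back: an edge leading up from \<open>a\<close> would
  return to the parent from which \<open>a\<close> was entered.\<close>

lemma path_snoc:
  "path n ends 0 (q @ [(e, y)]) t \<Longrightarrow> y = t \<and> (\<exists>u. (u, e, y) \<in> set as \<and> path n ends 0 q u)"
proof (induction q arbitrary: e y t rule: rev_induct)
  case Nil
  then have *: "y = t" "e \<in> edges n" "joins ends e 0 y" "y \<noteq> 0"
    by (auto simp: path_def)
  then obtain u x where a: "(u, e, x) \<in> set as" using edge_arcs by force
  \<comment> \<open>The other orientation would make the root a child.\<close>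
  then have "u = 0 \<and> x = y"
    using * arc[OF a] joins_cases[of ends e 0 y u x] by auto
  then show ?case using a *(1) by (auto simp: path_def)
next
  case (snoc s q)
  obtain f a where s: "s = (f, a)" by (cases s)
  have p: "path n ends 0 (q @ [(f, a)]) a" and *: "y = t" "e \<in> edges n" "joins ends e a y"
    and d: "y \<notin> set (0 # map snd (q @ [(f, a)]))"
    using snoc.prems unfolding s by (auto simp: path_def walk_append)
  obtain v where v: "(v, f, a) \<in> set as" "path n ends 0 q v"
    using snoc.IH[OF p] by blast
  obtain u x where a: "(u, e, x) \<in> set as" using *(2) edge_arcs by force
  have "a = u \<and> y = x \<or> a = x \<and> y = u"
    using *(3) arc(2)[OF a] joins_cases by blast
  then show ?case
  proof
    assume "a = u \<and> y = x"
    then show ?thesis using a p s *(1) by blast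
  next
    assume "a = x \<and> y = u"
    then have "y = v" using arc_cong[OF a v(1)] by simp
    then have "y \<in> set (0 # map snd q)"
      using walk_end[of n ends 0 q v] v(2) by (simp add: path_def)
    then show ?thesis using d by auto
  qed
qed

lemma path_to_root: "path n ends 0 p 0 \<longleftrightarrow> p = []"
proof
  assume "path n ends 0 p 0"
  then show "p = []"
    using walk_end[of n ends] by (cases p rule: rev_cases) (auto simp: path_def walk_append)
qed (simp add: path_def)

text \<open>The last step uses the only arc into \<open>t\<close>, so removing it from both paths
  leaves paths to the same parent. This makes the definite description in \<open>root_path\<close>
  meaningful.\<close>

lemma path_unique: "path n ends 0 p t \<Longrightarrow> path n ends 0 q t \<Longrightarrow> p = q"
proof (induction p arbitrary: t q rule: rev_induct)
  case Nil
  then show ?case using path_to_root by (simp add: path_def)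
next
  case (snoc s p)
  obtain e y where s: "s = (e, y)" by (cases s)
  obtain u where u: "y = t" "(u, e, t) \<in> set as" "path n ends 0 p u"
    using path_snoc snoc.prems(1) s by blast
  then have "q \<noteq> []"
    using arc(4)[OF u(2)] snoc.prems(2) by (auto simp: path_def)
  then obtain q' e' y' where q: "q = q' @ [(e', y')]"
    by (metis prod.collapse rev_exhaust)
  obtain u' where u': "y' = t" "(u', e', t) \<in> set as" "path n ends 0 q' u'"
    using path_snoc snoc.prems(2) q by blast
  have "u' = u" "e' = e" using arc_cong[OF u'(2) u(2)] by auto
  then show ?case using snoc.IH u(3) u'(3) u(1) u'(1) s q by blast
qed

lemma path_arcs: "path n ends 0 p t \<Longrightarrow> (f, z) \<in> set p \<Longrightarrow> \<exists>u. (u, f, z) \<in> set as"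
proof (induction p arbitrary: t rule: rev_induct)
  case (snoc s p)
  obtain e y where s: "s = (e, y)" by (cases s)
  obtain u where "(u, e, y) \<in> set as" "path n ends 0 p u"
    using path_snoc snoc.prems(1) s by blast
  then show ?case using snoc s by auto
qed simp

lemma root_path_eq: "path n ends 0 p t \<Longrightarrow> root_path n ends t = fst ` set p"
  unfolding root_path_def using path_unique by (metis (no_types, lifting) the_equality)

lemma root_path_root [simp]: "root_path n ends 0 = {}"
  using root_path_eq[of "[]" 0] path_to_root by simp

text \<open>The path to \<open>x\<close> can only end with the arc \<open>(v, e, x)\<close>. Its
  edge does not occur earlier, because \<open>x\<close> would then be visited twice.\<close>

lemma root_path_arc:
  assumes "(v, e, x) \<in> set as"
  shows "root_path n ends x = insert e (root_path n ends v)" "e \<notin> root_path n ends v"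
proof -
  have "x \<in> nodes n" using assms reached_arcs by (force simp: reached_def)
  then obtain p0 where "walk n ends 0 p0 x"
    using tree by (force simp: is_tree_def nodes_def)
  then obtain p where p: "path n ends 0 p x" using walk_imp_path by blast
  then have "p \<noteq> []" using arc(4)[OF assms] by (auto simp: path_def)
  then obtain q e' y where q: "p = q @ [(e', y)]"
    by (metis prod.collapse rev_exhaust)
  obtain u where u: "y = x" "(u, e', x) \<in> set as" "path n ends 0 q u"
    using path_snoc p q by blast
  then have eq: "u = v" "e' = e" using arc_cong[OF u(2) assms] by auto
  have v: "root_path n ends v = fst ` set q"
    using root_path_eq u(3) eq by blast
  then show "root_path n ends x = insert e (root_path n ends v)"
    using root_path_eq[OF p] q eq by auto
  show "e \<notin> root_path n ends v"
  proof
    assume "e \<in> root_path n ends v"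
    then obtain z where z: "(e, z) \<in> set q" using v by auto
    then obtain u' where "(u', e, z) \<in> set as" using path_arcs u(3) by blast
    then have "z = x" using arc_cong[OF _ assms] by force
    then show False using z p q u(1) by (force simp: path_def)
  qed
qed

lemma root_path_edges: "t \<in> nodes n \<Longrightarrow> root_path n ends t \<subseteq> edges n"
  by (induction t rule: node_induct) (auto simp: root_path_arc arc(1))

text \<open>A root path through \<open>e\<close> either ends at \<open>x\<close> or leaves
  \<open>x\<close> by exactly one arc. Expressed in numbers, this can be summed over all leaves to
  give the recursion for the leaf counts.\<close>

lemma on_root_path_iff:
  assumes "t \<in> nodes n" and ex: "(v, e, x) \<in> set as"
  shows "of_bool (e \<in> root_path n ends t) =
    (of_bool (t = x) + (\<Sum>a\<in>arcs_from as x. of_bool (edge a \<in> root_path n ends t)) :: nat)"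
  using assms(1)
proof (induction rule: node_induct)
  case root
  then show ?case using arc(4)[OF ex] by simp
next
  case (arc u g t)
  note R = root_path_arc[OF arc(1)]
  let ?A = "arcs_from as x"
  have eg: "e = g \<longleftrightarrow> t = x"
    using arc_cong[OF arc(1) ex] by (metis fst_conv snd_conv)
  \<comment> \<open>Only the arc \<open>(u, g, t)\<close> carries the edge \<open>g\<close>, and it
    belongs to \<open>?A\<close> when it starts at \<open>x\<close>.\<close>
  have "(\<Sum>a\<in>?A. of_bool (edge a = g)) = (\<Sum>a\<in>?A. if a = (u, g, t) then 1 else 0 :: nat)"
    using arc_cong[OF _ arc(1)] by (intro sum.cong) (auto simp: arcs_from_def)
  also have "\<dots> = of_bool (u = x)"
    using arc(1) unfolding sum.delta[OF finite_arcs_from] by (simp add: arcs_from_def)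
  finally have sum: "(\<Sum>a\<in>?A. of_bool (edge a = g)) = (of_bool (u = x) :: nat)" .
  have split: "of_bool (f \<in> root_path n ends t) = (of_bool (f = g) + of_bool (f \<in> root_path n ends u) :: nat)" for f
    using R by auto
  show ?case
    unfolding split sum.distrib sum arc(3) eg by simp
qed

lemma card_leaves_below:
  assumes ex: "(v, e, x) \<in> set as"
  shows "card (leaves_below n ends e) =
    (if x \<in> leaves n ends then 1 else
       \<Sum>a\<in>arcs_from as x. card (leaves_below n ends (edge a)))"
proof -
  let ?L = "leaves n ends" and ?A = "arcs_from as x"
  have fin: "finite ?L" by (auto simp: leaves_def nodes_def)
  have card: "card (leaves_below n ends f) = (\<Sum>t\<in>?L. of_bool (f \<in> root_path n ends t))" for f
    using fin by (simp add: leaves_below_def sum.If_cases of_bool_def Int_def)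
  have "card (leaves_below n ends e) =
     (\<Sum>t\<in>?L. of_bool (t = x) + (\<Sum>a\<in>?A. of_bool (edge a \<in> root_path n ends t)))"
    unfolding card by (intro sum.cong refl on_root_path_iff[OF _ ex]) (simp add: leaves_def)
  also have "\<dots> = of_bool (x \<in> ?L) + (\<Sum>a\<in>?A. card (leaves_below n ends (edge a)))"
    unfolding sum.distrib card using fin by (subst (2) sum.swap) (simp add: of_bool_def sum.delta)
  also have "\<dots> = (if x \<in> ?L then 1 else \<Sum>a\<in>?A. card (leaves_below n ends (edge a)))"
  proof -
    \<comment> \<open>The only edge at a leaf is the one from its parent, so no arc starts there and
      the sum vanishes.\<close>
    have "?A = {}" if "x \<in> ?L"
    proof (rule ccontr)
      assume "?A \<noteq> {}"
      then obtain f z where z: "(x, f, z) \<in> set as" by (auto simp: arcs_from_def)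
      have "{e, f} \<subseteq> incident n ends x"
        using arc(1,2)[OF ex] arc(1,2)[OF z] joins_sym[of ends e v x] by (auto intro: incident_joins)
      moreover have "card (incident n ends x) = 1" using that by (simp add: leaves_def)
      ultimately have "e = f" by (metis card_1_singletonE insert_subset singletonD)
      then show False using arc_cong[OF ex z] arc(5)[OF ex] by simp
    qed
    then show ?thesis by simp
  qed
  finally show ?thesis .
qed

text \<open>The list \<open>bs\<close> holds the arcs already processed. The loop runs against the
  order of growth, so all arcs leaving \<open>x\<close> are in \<open>bs\<close> and
  \<open>cnt x\<close> is complete when the arc into \<open>x\<close> is handled.\<close>

lemma leaf_counts_t:
  assumes "\<And>x. x \<noteq> 0 \<Longrightarrow> is_leaf inc x \<longleftrightarrow> x \<in> leaves n ends"
  shows "as = bs @ cs \<Longrightarrow>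
    (\<And>y. cnt y = (\<Sum>a\<in>arcs_from bs y. card (leaves_below n ends (edge a)))) \<Longrightarrow>
    (\<And>e. e \<in> edge ` set bs \<Longrightarrow> L e = card (leaves_below n ends e)) \<Longrightarrow>
    e \<in> edges n \<Longrightarrow>
    fst (leaf_counts_t inc cs cnt L) e = card (leaves_below n ends e)"
proof (induction cs arbitrary: bs cnt L)
  case Nil
  then show ?case using edge_arcs by simp
next
  case (Cons a cs)
  obtain v f x where a: "a = (v, f, x)" by (cases a)
  have ex: "(v, f, x) \<in> set as" using Cons.prems(1) a by simp
  have g: "grown n ends (a # cs)"
    using grown Cons.prems(1) grown_append by blast
  have "parent b \<noteq> x" if "b \<in> set (a # cs)" for b
  proof -
    have "parent b \<in> reached cs"
      using that g a grown_arc[of n ends cs "fst b" "fst (snd b)" "snd (snd b)"] by auto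
    then show ?thesis using g a by auto
  qed
  then have "arcs_from as x = arcs_from bs x"
    using Cons.prems(1) by (auto simp: arcs_from_def)
  then have k: "card (leaves_below n ends f) = (if is_leaf inc x then 1 else cnt x)"
    using card_leaves_below[OF ex] assms arc(4)[OF ex] Cons.prems(2) by simp
  let ?k = "card (leaves_below n ends f)"
  have "distinct as" using grown_distinct[OF grown] unfolding distinct_map by blast
  then have notin: "a \<notin> set bs" using Cons.prems(1) by simp
  have "fst (leaf_counts_t inc cs (cnt(v := cnt v + ?k)) (L(f := ?k))) e = card (leaves_below n ends e)"
  proof (rule Cons.IH[of "bs @ [a]"])
    show "(cnt(v := cnt v + ?k)) y =
        (\<Sum>b\<in>arcs_from (bs @ [a]) y. card (leaves_below n ends (edge b)))" for y
    proof (cases "y = v")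
      case True
      then have "arcs_from (bs @ [a]) y = insert a (arcs_from bs y)"
        using a by (auto simp: arcs_from_def)
      moreover have "a \<notin> arcs_from bs y" using notin by (simp add: arcs_from_def)
      ultimately show ?thesis using True Cons.prems(2) a by simp
    next
      case False
      then have "arcs_from (bs @ [a]) y = arcs_from bs y"
        using a by (auto simp: arcs_from_def)
      then show ?thesis using False Cons.prems(2) by simp
    qed
  qed (use Cons.prems a in auto)
  then show ?case using a k by simp
qed

text \<open>Double counting of the pairs of a leaf and an edge on its root path.\<close>

lemma tree_weight_leaves_below:
  "tree_weight n ends x = (\<Sum>e\<in>edges n. real (card (leaves_below n ends e)) * x e)"
proof -
  let ?L = "leaves n ends"
  have fin: "finite ?L" "finite (edges n)" by (auto simp: leaves_def nodes_def edges_def)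
  have "tree_weight n ends x = (\<Sum>t\<in>?L. \<Sum>e\<in>edges n. of_bool (e \<in> root_path n ends t) * x e)"
    unfolding tree_weight_def path_weight_def
  proof (rule sum.cong[OF refl])
    fix t assume "t \<in> ?L"
    then have "root_path n ends t = edges n \<inter> {e. e \<in> root_path n ends t}"
      using root_path_edges by (auto simp: leaves_def)
    then show "sum x (root_path n ends t) = (\<Sum>e\<in>edges n. of_bool (e \<in> root_path n ends t) * x e)"
      using fin(2) by (simp add: of_bool_def if_distrib[of "\<lambda>c. c * _"] sum.If_cases cong: if_cong)
  qed
  also have "\<dots> = (\<Sum>e\<in>edges n. \<Sum>t\<in>?L. of_bool (e \<in> root_path n ends t) * x e)"
    by (rule sum.swap)
  also have "\<dots> = (\<Sum>e\<in>edges n. real (card (leaves_below n ends e)) * x e)"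
    using fin(1) by (intro sum.cong refl)
      (simp add: sum_distrib_right[symmetric] leaves_below_def of_bool_def sum.If_cases Int_def)
  finally show ?thesis .
qed

text \<open>The arcs of \<open>cs\<close> are done and \<open>bs\<close> is read from its end,
  following the growth of the tree; hence \<open>d\<close> already holds the distance of the parent
  when an arc is handled.\<close>

lemma distances_t:
  assumes leaf: "\<And>x. x \<noteq> 0 \<Longrightarrow> is_leaf inc x \<longleftrightarrow> x \<in> leaves n ends"
  shows "as = bs @ cs \<Longrightarrow>
    (\<And>y. y \<in> reached cs \<Longrightarrow> d y = path_weight n ends x y) \<Longrightarrow>
    r = (\<Sum>t\<in>leaves n ends \<inter> child ` set cs. path_weight n ends x t) \<Longrightarrow>
    fst (distances_t inc x (rev bs) d r) = tree_weight n ends x"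
proof (induction bs arbitrary: cs d r rule: rev_induct)
  case Nil
  have "leaves n ends \<subseteq> child ` set as"
    using reached_arcs[symmetric] by (auto simp: leaves_def reached_def)
  then show ?case using Nil by (simp add: tree_weight_def Int_absorb2)
next
  case (snoc a bs)
  obtain v e y where a: "a = (v, e, y)" by (cases a)
  have ex: "(v, e, y) \<in> set as" using snoc.prems(1) a by simp
  have "grown n ends (a # cs)"
    using grown snoc.prems(1) grown_append[of n ends bs "a # cs"] by simp
  then have g: "v \<in> reached cs" "y \<notin> reached cs" using a by auto
  have "finite (root_path n ends v)"
    using root_path_edges[of v] arc(3)[OF ex] reached_arcs finite_subset[of _ "edges n"]
    by (auto simp: edges_def)
  then have y: "path_weight n ends x y = d v + x e"
    using root_path_arc[OF ex] snoc.prems(2)[OF g(1)] by (simp add: path_weight_def)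
  have fin: "finite (leaves n ends)" by (auto simp: leaves_def nodes_def)
  have "fst (distances_t inc x (rev bs) (d(y := d v + x e))
      (if is_leaf inc y then r + (d v + x e) else r)) = tree_weight n ends x"
  proof (rule snoc.IH[of "a # cs"])
    show "as = bs @ a # cs" using snoc.prems(1) by simp
    show "(d(y := d v + x e)) z = path_weight n ends x z" if "z \<in> reached (a # cs)" for z
      using that y snoc.prems(2) a by auto
    have "y \<notin> leaves n ends \<inter> child ` set cs" using g(2) by (auto simp: reached_def)
    then show "(if is_leaf inc y then r + (d v + x e) else r) =
        (\<Sum>t\<in>leaves n ends \<inter> child ` set (a # cs). path_weight n ends x t)"
      using leaf arc(4)[OF ex] fin y snoc.prems(3) a by (simp add: Int_insert_right)
  qed
  then show ?case using a by (cases "is_leaf inc y") simp_all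
qed

corollary fst_tree_weight_t:
  assumes "\<And>x. x \<noteq> 0 \<Longrightarrow> is_leaf inc x \<longleftrightarrow> x \<in> leaves n ends"
  shows "fst (tree_weight_t n inc (rev as) x) = tree_weight n ends x"
  using distances_t[OF assms, of as "[]" "\<lambda>_. 0" x 0]
  by (simp add: tree_weight_t_def path_weight_def new_array_def)

end

section \<open>Results and costs of the remaining loops\<close>

lemma snd_push_t: "snd (push_t ends e x fs st) = Suc (length fs)"
  by (induction fs arbitrary: st) auto

text \<open>An iteration costs the length of the child's incidence list plus 2, one step for the arc
  and one for the end of \<open>push_t\<close>. The share of \<open>acc\<close> on the left makes
  the equation stable under the induction.\<close>

lemma snd_traverse_t:
  "snd (traverse_t ends inc k st acc) + (\<Sum>a\<leftarrow>acc. length (inc (child a)) + 2) =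
     Suc (\<Sum>a\<leftarrow>fst (traverse_t ends inc k st acc). length (inc (child a)) + 2)"
proof (induction k arbitrary: st acc)
  case (Suc k)
  show ?case
  proof (cases st)
    case (Cons a st')
    obtain v e x where a: "a = (v, e, x)" by (cases a)
    show ?thesis
      using Suc[of "fst (push_t ends e x (inc x) st')" "(v, e, x) # acc"] Cons a
      by (simp add: snd_push_t)
  qed simp
qed simp

lemma snd_incidence_t: "snd (incidence_t ends m inc) = 3 * m + 1"
  by (induction m arbitrary: inc) (simp_all split: prod.splits)

text \<open>The assumption excludes loops, which would be entered twice in the same list.\<close>

lemma fst_incidence_t:
  assumes "\<And>e. e \<in> {1..m} \<Longrightarrow> fst (ends e) \<noteq> snd (ends e)"
  shows "fst (incidence_t ends m inc) x =
    filter (\<lambda>e. x = fst (ends e) \<or> x = snd (ends e)) [1..<Suc m] @ inc x"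
  using assms
proof (induction m arbitrary: inc)
  case (Suc m)
  obtain a b where ab: "ends (Suc m) = (a, b)" by (cases "ends (Suc m)")
  have "a \<noteq> b" using Suc.prems[of "Suc m"] ab by simp
  then show ?case using Suc ab by auto
qed simp

lemma snd_leaf_counts_t: "snd (leaf_counts_t inc as cnt L) = 3 * length as + 1"
  by (induction as arbitrary: cnt L) auto

lemma snd_distances_t: "snd (distances_t inc x as d r) = 2 * length as + 1"
  by (induction as arbitrary: d r) auto

lemma snd_tree_weight_t: "snd (tree_weight_t n inc as x) = n + 2 * length as + 2"
  by (simp add: tree_weight_t_def snd_distances_t)

lemma snd_max_weights_t: "snd (max_weights_t I m wb) = m + 1"
  by (induction m arbitrary: wb) simp_all

lemma fst_max_weights_t:
  "fst (max_weights_t I m wb) e = (if e \<in> {1..m} then max_weight I e else wb e)"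
  by (induction m arbitrary: wb) (auto simp: max_weight_def le_Suc_eq)

lemma snd_gains_t: "snd (gains_t I L wb m S) = m + 1"
  by (induction m arbitrary: S) simp_all

lemma fst_gains_t:
  "fst (gains_t I L wb m S) e = (if e \<in> {1..m} then real (L e) * (wb e - weight I e) else S e)"
  by (induction m arbitrary: S) (auto simp: le_Suc_eq)

lemma snd_to_list_t: "snd (to_list_t S m xs) = m + 1"
  by (induction m arbitrary: xs) simp_all

lemma fst_to_list_t: "fst (to_list_t S m xs) = map S [1..<Suc m] @ xs"
  by (induction m arbitrary: xs) simp_all

lemma snd_count_above_t: "snd (count_above_t S t m) = m + 1"
  by (induction m) simp_all

lemma card_filter_Suc:
  "card {e \<in> {1..Suc m}. P e} =
     (if P (Suc m) then Suc (card {e \<in> {1..m}. P e}) else card {e \<in> {1..m}. P e})"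
proof -
  have "{e \<in> {1..Suc m}. P e} =
      (if P (Suc m) then insert (Suc m) {e \<in> {1..m}. P e} else {e \<in> {1..m}. P e})"
    by (auto simp: le_Suc_eq)
  then show ?thesis by simp
qed

lemma fst_count_above_t: "fst (count_above_t S t m) = card {e \<in> {1..m}. S e > t}"
proof (induction m)
  case (Suc m)
  then show ?case unfolding card_filter_Suc by simp
qed simp

lemma snd_assign_t: "snd (assign_t I wb S t r m x) = 3 * m + 1"
  by (induction m arbitrary: r x) simp_all

text \<open>The set collects the edges above the threshold and, from the highest index down, tied
  edges as long as \<open>r\<close> lasts. Stating the cardinality with \<open>min\<close> keeps the
  claim valid for every remaining allowance.\<close>

lemma fst_assign_t:
  "\<exists>F. {e \<in> {1..m}. S e > t} \<subseteq> F \<and> F \<subseteq> {e \<in> {1..m}. S e \<ge> t} \<and>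
     card F = card {e \<in> {1..m}. S e > t} + min r (card {e \<in> {1..m}. S e = t}) \<and>
     (\<forall>e. fst (assign_t I wb S t r m x) e =
        (if e \<in> {1..m} then if e \<in> F then wb e else weight I e else x e))"
proof (induction m arbitrary: r x)
  case (Suc m)
  define take_it where "take_it \<longleftrightarrow> S (Suc m) > t \<or> S (Suc m) = t \<and> r > 0"
  define r' where "r' = (if S (Suc m) = t then r - 1 else r)"
  define x' where "x' = x(Suc m := (if take_it then wb (Suc m) else weight I (Suc m)))"
  obtain F where F: "{e \<in> {1..m}. S e > t} \<subseteq> F" "F \<subseteq> {e \<in> {1..m}. S e \<ge> t}"
    "card F = card {e \<in> {1..m}. S e > t} + min r' (card {e \<in> {1..m}. S e = t})"
    "\<And>e. fst (assign_t I wb S t r' m x') e =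
        (if e \<in> {1..m} then if e \<in> F then wb e else weight I e else x' e)"
    using Suc.IH by meson
  define F' where "F' = (if take_it then insert (Suc m) F else F)"
  have new: "Suc m \<notin> F" using F(2) by auto
  have fin: "finite F" using F(2) by (rule finite_subset) simp
  have "{e \<in> {1..Suc m}. S e > t} \<subseteq> F'"
    using F(1) by (auto simp: F'_def take_it_def le_Suc_eq)
  moreover have "F' \<subseteq> {e \<in> {1..Suc m}. S e \<ge> t}"
    using F(2) by (auto simp: F'_def take_it_def)
  moreover have "card F' = card {e \<in> {1..Suc m}. S e > t} + min r (card {e \<in> {1..Suc m}. S e = t})"
    using F(3) new fin unfolding card_filter_Suc by (auto simp: F'_def take_it_def r'_def)
  moreover have "fst (assign_t I wb S t r (Suc m) x) e =
        (if e \<in> {1..Suc m} then if e \<in> F' then wb e else weight I e else x e)" for e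
  proof -
    have "fst (assign_t I wb S t r (Suc m) x) e = fst (assign_t I wb S t r' m x') e"
      by (simp add: r'_def x'_def take_it_def)
    then show ?thesis
      using F(4)[of e] new by (auto simp: F'_def x'_def le_Suc_eq)
  qed
  ultimately show ?case by blast
qed auto

section \<open>Optimality\<close>

text \<open>Exchange argument: elements of \<open>D\<close> outside \<open>F\<close> contribute at
  most \<open>t\<close> each, those of \<open>F\<close> outside \<open>D\<close> at least
  \<open>t\<close>, and the latter are no fewer. Nonnegativity of \<open>t\<close> takes care of a
  larger \<open>F\<close>.\<close>

lemma sum_le_sum_largest:
  fixes g :: "'a \<Rightarrow> real"
  assumes fin: "finite E" and "D \<subseteq> E" "card D \<le> card F" "0 \<le> t"
    and F: "{e \<in> E. g e > t} \<subseteq> F" "F \<subseteq> {e \<in> E. g e \<ge> t}"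
  shows "sum g D \<le> sum g F"
proof -
  have D: "finite D" and F': "finite F" using finite_subset[OF _ fin] assms by auto
  have "card (D - F) \<le> card (F - D)"
    using card_Diff_subset_Int[of D F] card_Diff_subset_Int[of F D] D F' assms(3)
    by (simp add: Int_commute)
  then have "real (card (D - F)) * t \<le> real (card (F - D)) * t"
    using \<open>0 \<le> t\<close> by (intro mult_right_mono) auto
  moreover have "sum g (D - F) \<le> real (card (D - F)) * t"
    using F(1) \<open>D \<subseteq> E\<close> by (intro sum_bounded_above) force
  moreover have "real (card (F - D)) * t \<le> sum g (F - D)"
    using F(2) by (intro sum_bounded_below) auto
  ultimately have "sum g (D - F) \<le> sum g (F - D)" by linarith
  moreover have "sum g D = sum g (D - F) + sum g (D \<inter> F)" "sum g F = sum g (F - D) + sum g (D \<inter> F)"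
    using sum.Int_Diff[OF D, of g F] sum.Int_Diff[OF F', of g D] by (simp_all add: Int_commute add.commute)
  ultimately show ?thesis by simp
qed

lemma hamming_sum:
  "finite E \<Longrightarrow> (\<Sum>e\<in>E. hamming (x e) (w e)) = card {e \<in> E. x e \<noteq> w e}"
  by (simp add: hamming_def sum.If_cases Int_def)

lemma length_filter_map_upt:
  "length (filter P (map g [1..<Suc n])) = card {e \<in> {1..n}. P (g e)}"
proof -
  have "length (filter P (map g [1..<Suc n])) = length (filter (P \<circ> g) [1..<Suc n])"
    by (simp only: filter_map length_map)
  also have "\<dots> = card (set (filter (P \<circ> g) [1..<Suc n]))"
    by (rule distinct_card[symmetric]) simp
  also have "set (filter (P \<circ> g) [1..<Suc n]) = {e \<in> {1..n}. P (g e)}"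
    by auto
  finally show ?thesis .
qed

locale sdiptc_instance =
  fixes I :: sdiptc
  assumes valid: "valid_instance I"
begin

lemma size_pos: "1 \<le> size_of I"
  and edge_bounds: "e \<in> edges_of I \<Longrightarrow> weight I e \<le> upper I e" "e \<in> edges_of I \<Longrightarrow> 0 < unit_cost I e"
  and cost_bound_nonneg: "0 \<le> cost_bound I"
  using valid by (auto simp: valid_instance_def)

sublocale tree_graph "size_of I" "ends_of I"
  using valid by unfold_locales (simp add: valid_instance_def)

lemma finite_edges_of: "finite (edges_of I)"
  by (simp add: edges_of_def edges_def)

lemma edges_of_nonempty: "edges_of I \<noteq> {}"
  using size_pos by (auto simp: edges_of_def edges_def)

lemma max_weight_bounds:
  assumes "e \<in> edges_of I"
  shows "weight I e \<le> max_weight I e" "max_weight I e \<le> upper I e"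
    "unit_cost I e * (max_weight I e - weight I e) \<le> cost_bound I"
proof -
  note b = edge_bounds[OF assms] cost_bound_nonneg
  show "weight I e \<le> max_weight I e" "max_weight I e \<le> upper I e"
    using b by (auto simp: max_weight_def)
  have "max_weight I e - weight I e \<le> cost_bound I / unit_cost I e"
    by (simp add: max_weight_def)
  then show "unit_cost I e * (max_weight I e - weight I e) \<le> cost_bound I"
    using b(2) by (simp add: pos_le_divide_eq mult.commute)
qed

lemma gain_nonneg: "e \<in> edges_of I \<Longrightarrow> 0 \<le> gain I e"
  using max_weight_bounds(1) by (simp add: gain_def)

text \<open>The bound on the maximal cost acts on each edge separately; only the bound on the number
  of changes couples the edges.\<close>

lemma feasible_le_max_weight:
  assumes "feasible I y" "e \<in> edges_of I"
  shows "y e \<le> max_weight I e"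
proof -
  have "unit_cost I e * (y e - weight I e) \<le> cost_bound I"
    using assms finite_edges_of edges_of_nonempty by (auto simp: feasible_def)
  then have "y e - weight I e \<le> cost_bound I / unit_cost I e"
    using edge_bounds(2)[OF assms(2)] by (simp add: pos_le_divide_eq mult.commute)
  moreover have "y e \<le> upper I e" using assms by (simp add: feasible_def)
  ultimately show ?thesis by (simp add: max_weight_def)
qed

text \<open>For \<open>count_bound I = 0\<close> the truncated subtraction gives position 0, which
  exists because there is at least one edge.\<close>

lemma kth_largest_threshold:
  "kth_largest (map (gain I) [1..<Suc (size_of I)]) (min (count_bound I) (size_of I) - 1) (threshold I)"
  unfolding threshold_def by (rule kth_largest_nth) (use size_pos in auto)

lemma threshold_nonneg: "0 \<le> threshold I"
proof -
  have "threshold I \<in> gain I ` edges_of I"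
    using kth_largest_in_set[OF kth_largest_threshold] by (auto simp: edges_of_def edges_def)
  then show ?thesis using gain_nonneg by auto
qed

lemma output_feasible:
  assumes "output_of_A I x"
  shows "feasible I x"
proof -
  obtain F where F: "selected I F"
    "\<And>e. e \<in> edges_of I \<Longrightarrow> x e = (if e \<in> F then max_weight I e else weight I e)"
    using assms by (auto simp: output_of_A_def)
  have "{e \<in> edges_of I. x e \<noteq> weight I e} \<subseteq> F"
  proof (rule subsetI, rule ccontr)
    fix e assume "e \<in> {e \<in> edges_of I. x e \<noteq> weight I e}" "e \<notin> F"
    then show False using F(2)[of e] by simp
  qed
  moreover have "finite F"
    using F(1) finite_subset[OF _ finite_edges_of, of F] by (auto simp: selected_def)
  ultimately have "card {e \<in> edges_of I. x e \<noteq> weight I e} \<le> card F" by (intro card_mono)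
  then have "(\<Sum>e\<in>edges_of I. hamming (x e) (weight I e)) \<le> count_bound I"
    using F(1) by (simp add: hamming_sum finite_edges_of selected_def)
  moreover have "(MAX e\<in>edges_of I. unit_cost I e * (x e - weight I e)) \<le> cost_bound I"
    using F(2) max_weight_bounds cost_bound_nonneg finite_edges_of edges_of_nonempty by simp
  moreover have "\<forall>e\<in>edges_of I. weight I e \<le> x e \<and> x e \<le> upper I e"
    using F(2) max_weight_bounds edge_bounds(1) by simp
  ultimately show ?thesis by (simp add: feasible_def)
qed

text \<open>The linear form of the objective enters as a hypothesis because it is proved for a tree
  with an arc list, and such a list is supplied only by the run of the algorithm.\<close>

lemma output_optimal:
  assumes out: "output_of_A I x"
    and total: "\<And>y. total_distance I y =
      (\<Sum>e\<in>edges_of I. real (card (leaves_below (size_of I) (ends_of I) e)) * y e)"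
  shows "optimal I x"
proof -
  let ?E = "edges_of I" and ?l = "\<lambda>e. real (card (leaves_below (size_of I) (ends_of I) e))"
  obtain F where F: "selected I F"
    "\<And>e. e \<in> edges_of I \<Longrightarrow> x e = (if e \<in> F then max_weight I e else weight I e)"
    using out by (auto simp: output_of_A_def)
  have FE: "F \<subseteq> ?E" using F(1) by (auto simp: selected_def)
  have split: "total_distance I y = total_distance I (weight I) + (\<Sum>e\<in>?E. ?l e * (y e - weight I e))" for y
    unfolding total by (simp add: right_diff_distrib sum_subtractf)
  have "total_distance I y \<le> total_distance I x" if y: "feasible I y" for y
  proof -
    define D where "D = {e \<in> ?E. y e \<noteq> weight I e}"
    have "card D \<le> count_bound I"
      using y by (simp add: feasible_def hamming_sum finite_edges_of D_def)
    moreover have "card D \<le> size_of I"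
    proof -
      have "D \<subseteq> {1..size_of I}" by (auto simp: D_def edges_of_def edges_def)
      then show ?thesis using card_mono[of "{1..size_of I}" D] by simp
    qed
    ultimately have "card D \<le> card F" using F(1) by (simp add: selected_def)
    have "(\<Sum>e\<in>?E. ?l e * (y e - weight I e)) = (\<Sum>e\<in>D. ?l e * (y e - weight I e))"
      by (rule sum.mono_neutral_right) (auto simp: D_def finite_edges_of)
    also have "\<dots> \<le> sum (gain I) D"
      unfolding gain_def using feasible_le_max_weight[OF y]
      by (intro sum_mono mult_left_mono) (auto simp: D_def)
    also have "\<dots> \<le> sum (gain I) F"
      using F(1) \<open>card D \<le> card F\<close> threshold_nonneg
      by (intro sum_le_sum_largest[OF finite_edges_of]) (auto simp: D_def selected_def)
    also have "\<dots> = (\<Sum>e\<in>F. ?l e * (x e - weight I e))"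
      using F(2) FE by (intro sum.cong) (auto simp: gain_def)
    also have "\<dots> = (\<Sum>e\<in>?E. ?l e * (x e - weight I e))"
      using F(2) FE by (intro sum.mono_neutral_left) (auto simp: finite_edges_of)
    finally show ?thesis unfolding split[of y] split[of x] by simp
  qed
  then show ?thesis using output_feasible[OF out] by (simp add: optimal_def)
qed

end

section \<open>The run of the algorithm\<close>

context tree_graph
begin

lemma incidence_t_incident:
  fixes x
  defines "fs \<equiv> fst (incidence_t ends n (\<lambda>_. [])) x"
  shows "set fs = incident n ends x \<and> distinct fs"
proof -
  have "fs = filter (\<lambda>e. x = fst (ends e) \<or> x = snd (ends e)) [1..<Suc n]"
    unfolding fs_def using no_loop by (subst fst_incidence_t) (auto simp: edges_def)
  then show ?thesis by (auto simp: incident_def edges_def)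
qed

lemma is_leaf_iff:
  assumes "set (inc x) = incident n ends x \<and> distinct (inc x)" "x \<noteq> 0"
  shows "is_leaf inc x \<longleftrightarrow> x \<in> leaves n ends"
proof -
  have len: "length (inc x) = card (incident n ends x)"
    using assms(1) distinct_card[of "inc x"] by simp
  have "x \<in> nodes n" if "e \<in> incident n ends x" for e
    using that joins_opposite[OF that] ends_in_nodes by (auto simp: incident_def)
  then have "card (incident n ends x) = 1 \<Longrightarrow> x \<in> nodes n"
    by (metis card.empty equals0I zero_neq_one)
  moreover have "is_leaf inc x \<longleftrightarrow> length (inc x) = 1"
    by (auto simp: is_leaf_def split: list.splits)
  ultimately show ?thesis using assms(2) len by (auto simp: leaves_def)
qed

text \<open>Double counting: an edge is incident to at most its two end points.\<close>

lemma sum_card_incident: "(\<Sum>x\<in>nodes n. card (incident n ends x)) \<le> 2 * n"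
proof -
  have fin: "finite (edges n)" "finite (nodes n)" by (auto simp: edges_def nodes_def)
  have "(\<Sum>x\<in>nodes n. card (incident n ends x)) =
      (\<Sum>x\<in>nodes n. \<Sum>e\<in>edges n. of_bool (x = fst (ends e) \<or> x = snd (ends e)))"
    using fin by (intro sum.cong refl) (simp add: incident_def of_bool_def sum.If_cases Int_def)
  also have "\<dots> = (\<Sum>e\<in>edges n. \<Sum>x\<in>nodes n. of_bool (x = fst (ends e) \<or> x = snd (ends e)))"
    by (rule sum.swap)
  also have "\<dots> \<le> (\<Sum>e\<in>edges n. 2)"
  proof (rule sum_mono)
    fix e
    have "(\<Sum>x\<in>nodes n. of_bool (x = fst (ends e) \<or> x = snd (ends e)) :: nat)
        = card {x \<in> nodes n. x = fst (ends e) \<or> x = snd (ends e)}"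
      using fin by (simp add: of_bool_def sum.If_cases Int_def)
    also have "\<dots> \<le> card {fst (ends e), snd (ends e)}"
      by (rule card_mono) auto
    also have "\<dots> \<le> 2" by (simp add: card_insert_if)
    finally show "(\<Sum>x\<in>nodes n. of_bool (x = fst (ends e) \<or> x = snd (ends e)) :: nat) \<le> 2" .
  qed
  also have "\<dots> = 2 * n" by (simp add: edges_def)
  finally show ?thesis .
qed

lemma traversal:
  assumes inc: "\<And>x. set (inc x) = incident n ends x \<and> distinct (inc x)"
  shows "rooted_tree n ends (fst (traverse_t ends inc n (fst (push_t ends 0 0 (inc 0) [])) []))"
proof -
  let ?st = "fst (push_t ends 0 0 (inc 0) [])"
  have "frontier n ends [] ?st \<and> edge ` set ?st = edge ` set [] \<union> (set (inc 0) - {0})"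
    by (rule frontier_push_t) (use inc in \<open>auto simp: frontier_def\<close>)
  \<comment> \<open>The number 0 given to the root as parent edge is no edge, so
    \<open>push_t\<close> skips nothing there.\<close>
  moreover have "0 \<notin> incident n ends 0" by (auto simp: incident_def edges_def)
  ultimately have "frontier n ends [] ?st" "edge ` set ?st = incident n ends 0"
    using inc by auto
  then have "grown n ends (fst (traverse_t ends inc n ?st [])) \<and>
      edge ` set (fst (traverse_t ends inc n ?st [])) = edges n"
    by (intro traverse_t_grown[OF inc, where acc = "[]"]) auto
  then show ?thesis by unfold_locales auto
qed

end

lemma (in rooted_tree) length_arcs: "length as = n"
  using grown_distinct[OF grown] edge_arcs distinct_card[of "map edge as"] by (simp add: edges_def)

text \<open>As the children are distinct, their incidence lists are bounded by the sum of the
  degrees, at most \<open>2 * n\<close>; the overhead of 2 per arc adds another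
  \<open>2 * n\<close>.\<close>

lemma (in rooted_tree) traversal_cost:
  assumes "\<And>x. set (inc x) = incident n ends x \<and> distinct (inc x)"
  shows "(\<Sum>a\<leftarrow>as. length (inc (child a)) + 2) \<le> 4 * n"
proof -
  have len: "length (inc x) = card (incident n ends x)" for x
    using assms[of x] distinct_card[of "inc x"] by simp
  have d: "distinct (map child as)" using grown_distinct[OF grown] by simp
  have "(\<Sum>a\<leftarrow>as. length (inc (child a)) + 2) = (\<Sum>x\<leftarrow>map child as. card (incident n ends x)) + 2 * length as"
    unfolding len by (induction as) simp_all
  also have "(\<Sum>x\<leftarrow>map child as. card (incident n ends x)) = (\<Sum>x\<in>child ` set as. card (incident n ends x))"
    using d by (subst sum_list_distinct_conv_sum_set) auto
  also have "\<dots> \<le> (\<Sum>x\<in>nodes n. card (incident n ends x))"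
    using reached_arcs by (intro sum_mono2) (auto simp: reached_def nodes_def)
  also have "\<dots> \<le> 2 * n" by (rule sum_card_incident)
  finally show ?thesis using length_arcs by simp
qed

context sdiptc_instance
begin

lemma algorithm_A_run:
  shows "output_of_A I (fst (fst (algorithm_A I)))"
    and "optimal I (fst (fst (algorithm_A I)))"
    and "snd (fst (algorithm_A I)) = total_distance I (fst (fst (algorithm_A I)))"
    and "running_time I \<le> 1300 * size_of I + 11000"
proof -
  define n where "n = size_of I"
  define N where "N = min (count_bound I) n"
  define inc where "inc = fst (incidence_t (ends_of I) n (\<lambda>_. []))"
  define st where "st = fst (push_t (ends_of I) 0 0 (inc 0) [])"
  define as where "as = fst (traverse_t (ends_of I) inc n st [])"
  define wb where "wb = fst (max_weights_t I n (\<lambda>_. 0))"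
  define L where "L = fst (leaf_counts_t inc as (\<lambda>_. 0) (\<lambda>_. 0))"
  define S where "S = fst (gains_t I L wb n (\<lambda>_. 0))"
  define Ss where "Ss = fst (to_list_t S n [])"
  \<comment> \<open>The form \<open>N - Suc 0\<close> is what \<open>One_nat_def\<close> leaves when
    the program is unfolded, so that this definition can be folded back.\<close>
  define t where "t = fst (select_t (N - Suc 0) Ss)"
  define above where "above = fst (count_above_t S t n)"
  define x where "x = fst (assign_t I wb S t (N - above) n (\<lambda>_. 0))"
  note folds = n_def[symmetric] N_def[symmetric] inc_def[symmetric] st_def[symmetric] as_def[symmetric]
    wb_def[symmetric] L_def[symmetric] S_def[symmetric] Ss_def[symmetric] t_def[symmetric]
    above_def[symmetric] x_def[symmetric]
  have result: "fst (algorithm_A I) = (x, fst (tree_weight_t n inc (rev as) x))"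
    unfolding algorithm_A_def
    by (simp only: fst_simps fst_rev_t append_Nil2 fst_new_array One_nat_def folds)
  have inc: "set (inc y) = incident n (ends_of I) y \<and> distinct (inc y)" for y
    unfolding inc_def n_def by (rule incidence_t_incident)
  interpret run: rooted_tree n "ends_of I" as
    unfolding as_def st_def using traversal inc by (simp add: n_def)
  have leaf: "is_leaf inc y \<longleftrightarrow> y \<in> leaves n (ends_of I)" if "y \<noteq> 0" for y
    using run.is_leaf_iff inc that by blast
  have E: "edges_of I = {1..n}" by (simp add: edges_of_def edges_def n_def)

  have "L e = card (leaves_below n (ends_of I) e)" if "e \<in> {1..n}" for e
    unfolding L_def by (rule run.leaf_counts_t[OF leaf, of "[]"]) (use that in \<open>auto simp: arcs_from_def edges_def\<close>)
  then have S: "S e = gain I e" if "e \<in> {1..n}" for e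
    using that by (simp add: S_def fst_gains_t wb_def fst_max_weights_t gain_def n_def)
  have "Ss = map (gain I) [1..<Suc n]"
    using S by (auto simp: Ss_def fst_to_list_t)
  then have t: "t = threshold I"
    using size_pos unfolding t_def
    by (subst fst_select_t) (auto simp: threshold_def N_def n_def min_def)
  have kth: "kth_largest (map (gain I) [1..<Suc n]) (N - 1) t"
    using kth_largest_threshold unfolding t n_def N_def .
  have gain_sets: "{e \<in> {1..n}. S e > t} = {e \<in> edges_of I. gain I e > t}"
    "{e \<in> {1..n}. S e \<ge> t} = {e \<in> edges_of I. gain I e \<ge> t}"
    using S E by auto
  have above: "above = card {e \<in> {1..n}. S e > t}"
    by (simp add: above_def fst_count_above_t)
  have "above \<le> N - 1" "N - 1 < card {e \<in> {1..n}. S e \<ge> t}"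
    using kth unfolding kth_largest_def length_filter_map_upt above gain_sets E by auto
  moreover have "card {e \<in> {1..n}. S e \<ge> t} = above + card {e \<in> {1..n}. S e = t}"
    unfolding above by (subst card_Un_disjoint[symmetric]) (auto intro!: arg_cong[of _ _ card])
  \<comment> \<open>For \<open>N = 0\<close> nothing lies above the threshold and no tied edge is
    taken. Otherwise fewer than \<open>N\<close> edges lie above, and there are enough ties to fill
    up to \<open>N\<close>.\<close>
  ultimately have count: "above + min (N - above) (card {e \<in> {1..n}. S e = t}) = N"
    by (cases N) auto
  obtain F where F: "{e \<in> {1..n}. S e > t} \<subseteq> F \<and> F \<subseteq> {e \<in> {1..n}. S e \<ge> t} \<and>
      card F = above + min (N - above) (card {e \<in> {1..n}. S e = t}) \<and>
      (\<forall>e. x e = (if e \<in> {1..n} then if e \<in> F then wb e else weight I e else 0))"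
    using fst_assign_t[of n t S "N - above" I wb "\<lambda>_. 0", folded x_def above] by (rule exE)
  have "selected I F"
  proof -
    have "card F = min (count_bound I) (size_of I)"
      using F count by (metis N_def n_def)
    then show ?thesis
      using F unfolding selected_def t[symmetric] gain_sets by blast
  qed
  moreover have "\<forall>e\<in>edges_of I. x e = (if e \<in> F then max_weight I e else weight I e)"
    using F by (simp add: E wb_def fst_max_weights_t)
  ultimately have out: "output_of_A I x" by (auto simp: output_of_A_def)
  then show "output_of_A I (fst (fst (algorithm_A I)))" by (simp add: result)
  have "total_distance I y = (\<Sum>e\<in>edges_of I. real (card (leaves_below (size_of I) (ends_of I) e)) * y e)" for y
    using run.tree_weight_leaves_below[of y] by (simp add: total_distance_def edges_of_def n_def)
  then show "optimal I (fst (fst (algorithm_A I)))"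
    using output_optimal[OF out] by (simp add: result)
  show "snd (fst (algorithm_A I)) = total_distance I (fst (fst (algorithm_A I)))"
    using run.fst_tree_weight_t[OF leaf] by (simp add: result total_distance_def n_def)

  have "snd (traverse_t (ends_of I) inc n st []) \<le> 4 * n + 1"
    using snd_traverse_t[of "ends_of I" inc n st "[]"] run.traversal_cost[OF inc] by (simp add: as_def)
  moreover have "length (inc 0) \<le> n"
  proof -
    have "set (inc 0) \<subseteq> {1..n}" using inc by (auto simp: incident_def edges_def)
    then have "card (set (inc 0)) \<le> n" using card_mono[of "{1..n}"] by fastforce
    then show ?thesis using inc[of 0] distinct_card by metis
  qed
  moreover have "snd (select_t (N - Suc 0) Ss) \<le> 1200 * n + 10200"
    using snd_select_t[of "N - Suc 0" Ss] size_pos by (auto simp: Ss_def fst_to_list_t N_def n_def)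
  \<comment> \<open>Apart from the traversal, the initial stack and the selection, all loops have
    explicit linear costs, together at most \<open>50 * n + 50\<close>.\<close>
  moreover have "running_time I \<le>
      snd (traverse_t (ends_of I) inc n st []) + length (inc 0)
        + snd (select_t (N - Suc 0) Ss) + 50 * n + 50"
    unfolding running_time_def algorithm_A_def
    by (simp only: snd_simps fst_simps fst_rev_t append_Nil2 fst_new_array snd_new_array
        One_nat_def folds snd_rev_t snd_incidence_t snd_push_t snd_max_weights_t snd_tree_weight_t
        snd_leaf_counts_t snd_gains_t snd_to_list_t snd_count_above_t snd_assign_t length_rev
        run.length_arcs)
  ultimately show "running_time I \<le> 1300 * size_of I + 11000"
    unfolding n_def by linarith
qed

end

theorem theorem4:
  shows "(\<forall>I :: sdiptc. valid_instance I \<longrightarrow>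
            (let (x, v) = fst (algorithm_A I)
             in output_of_A I x \<and> optimal I x \<and> v = total_distance I x)) \<and>
         (\<exists>f :: nat \<Rightarrow> real. f \<in> O(\<lambda>n. real n) \<and>
            (\<forall>I :: sdiptc. valid_instance I \<longrightarrow> real (running_time I) \<le> f (size_of I)))"
proof (intro conjI exI[of _ "\<lambda>n. real (1300 * n + 11000)"] allI impI)
  fix I assume "valid_instance I"
  then interpret sdiptc_instance I by unfold_locales
  show "let (x, v) = fst (algorithm_A I) in output_of_A I x \<and> optimal I x \<and> v = total_distance I x"
    using algorithm_A_run(1-3) by (simp add: case_prod_beta)
  show "real (running_time I) \<le> real (1300 * size_of I + 11000)"
    using algorithm_A_run(4) by (simp only: of_nat_le_iff)
next
  show "(\<lambda>n. real (1300 * n + 11000)) \<in> O(\<lambda>n. real n)"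
    \<comment> \<open>For \<open>n >= 1\<close> the additive constant is at most
      \<open>11000 * n\<close>, and 12300 = 1300 + 11000.\<close>
    by (intro bigoI[of _ 12300] eventually_sequentiallyI[of 1]) simp
qed

end
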